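(* Let $a,x,y,m,n,l$ be nonnegative integers with $a = x + 2^{mn}y$, where $n$ is a power of $2$, $y<2^n$, and $2^{(m+1)n} \mid x$. Suppose the period length of $x+1$ in $B_\infty$ (equivalently, the size of $\langle x\rangle$) is $2^l$, and $l \le n$. Then $\langle a\rangle$ is isomorphic to $\langle 2^{l+n}-2^n+y\rangle$, and the isomorphism is described as follows: for every $i\ge 0$, if $(2^{l+n}-2^n+y+1)\backslash i = 2^n w + y'$ with $y'<2^n$, then $(a+1)\backslash i = ((x+1)\backslash w) + 2^{mn}y'$.
   Context: For $n\ge0$, $B_n$ is the set $\{0,1,\dots,2^n-1\}$ with the binary operation $\backslash$ defined recursively by: $0\backslash x = x$; $x\backslash(2^n-1) = x-1$ for $x>0$; $x\backslash(y-1) = (x\backslash y)\backslash(x-1)$ for $x,y>0$. This is a well-defined left-distributive operation with $x\backslash y<x$ for $x\neq0$, and $B_n$ is a subalgebra of $B_N$ for $N\ge n$; $B_\infty$ is the union of all $B_n$ with operation $\backslash$ (on the nonnegative integers). For $x>0$ the sequence $x\backslash 0, x\backslash 1,\dots$ is periodic; its period length is the least positive $p$ with $x\backslash p = 0$, and it is a power of $2$. $\langle x\rangle$ denotes the subalgebra of $B_\infty$ generated by $x$, whose size equals the period length of $x+1$. Expressions like $u\backslash v + w$ mean $(u\backslash v)+w$. *)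

theory Defs
  imports Main
begin

text \<open>
  \<open>laver_fin n\<close> is the operation of the finite algebra \<open>B\<^sub>n\<close>, whose carrier is \<open>{..<2 ^ n}\<close>.
  The defining equation \<open>x \ (y - 1) = (x \ y) \ (x - 1)\<close> is read as a recursion that
  descends in \<open>x\<close> and ascends in \<open>y\<close>; values outside the carrier are irrelevant.
\<close>

function (domintros) laver_fin :: "nat \<Rightarrow> nat \<Rightarrow> nat \<Rightarrow> nat" where
  "laver_fin n x y =
     (if x = 0 then y
      else if y + 1 < 2 ^ n then laver_fin n (laver_fin n x (y + 1)) (x - 1)
      else x - 1)"
  by auto

lemma laver_fin_less_aux:
  assumes "laver_fin_dom (n, x, y)" and "x > 0"
  shows "laver_fin n x y < x"
  using assms
proof (induction n x y rule: laver_fin.pinduct)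
  case (1 n x y)
  note unfold = laver_fin.psimps [OF 1(1)]
  show ?case
  proof (cases "y + 1 < 2 ^ n")
    case True
    let ?z = "laver_fin n x (y + 1)"
    have z: "?z < x"
      by (rule 1(2) [OF _ True \<open>x > 0\<close>]) (use \<open>x > 0\<close> in simp)
    have "laver_fin n ?z (x - 1) < x"
    proof (cases "?z = 0")
      case True
      have "laver_fin_dom (n, 0, x - 1)"
        by (rule laver_fin.domintros) auto
      from laver_fin.psimps [OF this] have "laver_fin n 0 (x - 1) = x - 1"
        by (simp only: if_True refl)
      then show ?thesis
        using True \<open>x > 0\<close> by simp
    next
      case nz: False
      then have "?z > 0" by (rule neq0_conv [THEN iffD1])
      have "laver_fin n ?z (x - 1) < ?z"
        by (rule 1(3) [OF _ True \<open>?z > 0\<close>]) (use \<open>x > 0\<close> in simp)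
      with z show ?thesis by (rule order.strict_trans [rotated])
    qed
    then show ?thesis
      using True \<open>x > 0\<close> by (subst unfold) simp
  next
    case False
    then show ?thesis
      using \<open>x > 0\<close> by (subst unfold) simp
  qed
qed

termination
proof (relation "measures [\<lambda>(n, x, y). x, \<lambda>(n, x, y). 2 ^ n - y]")
  fix n x y :: nat
  assume "x \<noteq> 0" "y + 1 < 2 ^ n" "laver_fin_dom (n, x, y + 1)"
  then show "((n, laver_fin n x (y + 1), x - 1), n, x, y)
      \<in> measures [\<lambda>(n, x, y). x, \<lambda>(n, x, y). 2 ^ n - y]"
    using laver_fin_less_aux by simp
qed auto

declare laver_fin.simps [simp del]

lemma laver_fin_0: "laver_fin n 0 y = y"
  by (subst laver_fin.simps) simp

lemma laver_fin_top: "x > 0 \<Longrightarrow> laver_fin n x (2 ^ n - 1) = x - 1"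
  by (subst laver_fin.simps) simp

lemma laver_fin_rec:
  assumes "x > 0" "y > 0" "y < 2 ^ n"
  shows "laver_fin n x (y - 1) = laver_fin n (laver_fin n x y) (x - 1)"
  using assms by (subst laver_fin.simps) simp

lemma laver_fin_less:
  assumes "x > 0"
  shows "laver_fin n x y < x"
proof (rule laver_fin_less_aux [OF _ assms])
  show "laver_fin_dom (n, x, y)"
  proof (induction n x y rule: laver_fin.induct)
    case (1 n x y)
    show ?case
      by (rule laver_fin.domintros) (use 1 in simp_all)
  qed
qed

text \<open>
  The operation of \<open>B\<^sub>\<infinity>\<close>. Since \<open>B\<^sub>n\<close> is a subalgebra of \<open>B\<^sub>N\<close> for \<open>n \<le> N\<close>, any
  \<open>N\<close> with \<open>x, y < 2 ^ N\<close> gives the same value; the least one is taken.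
  The carrier is all of type \<^typ>\<open>nat\<close>.
\<close>

definition laver :: "nat \<Rightarrow> nat \<Rightarrow> nat"  (infixl \<open>\<rhd>\<close> 75) where
  "x \<rhd> y = laver_fin (LEAST N. x < 2 ^ N \<and> y < 2 ^ N) x y"

text \<open>
  Meant for \<open>x > 0\<close>: the sequence \<open>x \<rhd> 0, x \<rhd> 1, \<dots>\<close> is then periodic, starts with \<open>0\<close>,
  and has \<open>0\<close> exactly once in each period.
\<close>

definition laver_period :: "nat \<Rightarrow> nat" where
  "laver_period x = (LEAST p. p > 0 \<and> x \<rhd> p = 0)"

inductive_set laver_gen :: "nat \<Rightarrow> nat set" for x :: nat where
  base: "x \<in> laver_gen x"
| step: "u \<in> laver_gen x \<Longrightarrow> v \<in> laver_gen x \<Longrightarrow> u \<rhd> v \<in> laver_gen x"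

definition laver_iso :: "(nat \<Rightarrow> nat) \<Rightarrow> nat set \<Rightarrow> nat set \<Rightarrow> bool" where
  "laver_iso \<phi> A B \<longleftrightarrow>
     bij_betw \<phi> A B \<and> (\<forall>u\<in>A. \<forall>v\<in>A. \<phi> (u \<rhd> v) = \<phi> u \<rhd> \<phi> v)"

end

theory Submission
  imports Defs
begin

text \<open>
  The translations \<open>L\<^sub>x = (\<lambda>y. x \<rhd> y)\<close> satisfy \<open>L\<^sub>x \<circ> L\<^bsub>w+1\<^esub> = L\<^bsub>x \<rhd> w + 1\<^esub>\<close>, and \<open>\<langle>x\<rangle>\<close> is the image of
  \<open>L\<^bsub>x+1\<^esub>\<close>. With \<open>d = (m + 1) n\<close>, the heart of the matter is that \<open>L\<close> at \<open>x + 2\<^sup>d\<close> maps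
  \<open>2\<^sup>d w + y'\<close> to \<open>(x + 1) \<rhd> w + y'\<close>, and that multiplication by \<open>2 ^ (m n)\<close> is a homomorphism on
  \<open>B\<^bsub>2n\<^esub>\<close>; composing both gives the formula for \<open>L\<^bsub>a+1\<^esub>\<close>. The two facts are proved together by
  induction on \<open>log n\<close>: scaling on \<open>B\<^sub>n\<close> gives the block formula, which gives scaling on \<open>B\<^bsub>2n\<^esub>\<close>.
  The block formula also needs that \<open>z \<rhd> 2\<^sup>d = 0\<close> whenever \<open>z < 2 ^ (d + n)\<close> is not a multiple of
  \<open>2\<^sup>d\<close>; this holds because the smaller cases provide \<open>c\<close> with \<open>c \<rhd> 2 ^ (d - q) = 2\<^sup>d\<close>, so that
  \<open>z \<rhd> 2\<^sup>d = (z \<rhd> c) \<rhd> (z \<rhd> 2 ^ (d - q))\<close> reduces to the smaller element \<open>z \<rhd> c\<close>.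
\<close>

section \<open>The finite algebras\<close>

lemma laver_fin_Suc:
  assumes "x > 0" "Suc y < 2 ^ n"
  shows "laver_fin n x y = laver_fin n (laver_fin n x (Suc y)) (x - 1)"
  using laver_fin_rec [of x "Suc y" n] assms by simp

lemma laver_fin_mono:
  assumes "x > 0" "Suc y < 2 ^ n" "laver_fin n x (Suc y) > 0"
  shows "laver_fin n x y < laver_fin n x (Suc y)"
  using laver_fin_Suc [OF assms(1,2)] laver_fin_less [OF assms(3)] by simp

text \<open>Just below a zero the recursion restarts with \<open>x - 1\<close>, as it does at the
  top argument \<open>2 ^ n - 1\<close>, and within a row each value is determined by the next
  one.\<close>

lemma laver_fin_reset:
  assumes "x > 0" "y < 2 ^ n" "laver_fin n x y = 0" "0 < r" "r \<le> y"
  shows "laver_fin n x (y - r) = laver_fin n x (2 ^ n - r)"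
  using assms(4,5)
proof (induction r rule: nat_induct_non_zero)
  case 1
  have "laver_fin n x (y - 1) = x - 1"
    using laver_fin_Suc [of x "y - 1" n] assms 1 by (simp add: laver_fin_0)
  then show ?case using laver_fin_top [OF assms(1)] by simp
next
  case (Suc r)
  have "laver_fin n x (y - Suc r) = laver_fin n (laver_fin n x (y - r)) (x - 1)"
    using laver_fin_Suc [of x "y - Suc r" n] assms Suc by (simp add: Suc_diff_Suc)
  moreover have "laver_fin n x (2 ^ n - Suc r) = laver_fin n (laver_fin n x (2 ^ n - r)) (x - 1)"
    using laver_fin_Suc [of x "2 ^ n - Suc r" n] assms Suc by (simp add: Suc_diff_Suc)
  ultimately show ?case using Suc by simp
qed

text \<open>Each zero restarts the row, so the zero found \<open>2 ^ p\<close> below the top recurs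
  \<open>2 ^ p\<close> below every zero.\<close>

lemma laver_fin_zero_multiples:
  assumes "x > 0" "laver_fin n x (2 ^ n - 2 ^ p) = 0" "p \<le> n" "y < 2 ^ n" "2 ^ p dvd y"
  shows "laver_fin n x y = 0"
proof -
  have *: "laver_fin n x (2 ^ n - Suc j * 2 ^ p) = 0" if "Suc j * 2 ^ p \<le> 2 ^ n" for j
    using that
  proof (induction j)
    case 0
    then show ?case using assms by simp
  next
    case (Suc j)
    have "laver_fin n x (2 ^ n - Suc j * 2 ^ p) = 0" using Suc by simp
    moreover have "2 ^ n - Suc j * 2 ^ p < (2::nat) ^ n" by simp
    moreover have "2 ^ p \<le> 2 ^ n - Suc j * 2 ^ p" using Suc.prems by simp
    ultimately have "laver_fin n x (2 ^ n - Suc j * 2 ^ p - 2 ^ p) = 0"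
      using laver_fin_reset [of x "2 ^ n - Suc j * 2 ^ p" n "2 ^ p"] assms by simp
    then show ?case by (simp add: algebra_simps)
  qed
  have "2 ^ p dvd 2 ^ n - y"
    using assms by (intro dvd_diff_nat) (auto simp: le_imp_power_dvd)
  then obtain j where j: "2 ^ n - y = 2 ^ p * j" ..
  moreover have "j > 0" using j assms(4) by (cases j) auto
  then obtain i where "j = Suc i" using gr0_implies_Suc by blast
  ultimately have "y = 2 ^ n - Suc i * 2 ^ p" "Suc i * 2 ^ p \<le> 2 ^ n"
    using assms(4) by (auto simp: mult.commute)
  then show ?thesis using * by simp
qed

text \<open>The recursion respects reduction; \<open>Z\<close> covers the wrap-around at multiples
  of \<open>2 ^ n\<close>. It is a premise because \<open>laver_fin_zeros\<close> supplies it at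
  level \<open>n\<close> while being extended to level \<open>Suc n\<close>.\<close>

lemma laver_fin_mod_step:
  assumes Z: "\<And>x. 0 < x \<Longrightarrow> x < 2 ^ n \<Longrightarrow> laver_fin n x 0 = 0"
    and "x < 2 ^ Suc n" "y < 2 ^ Suc n"
  shows "laver_fin (Suc n) x y mod 2 ^ n = laver_fin n (x mod 2 ^ n) (y mod 2 ^ n)"
  using assms(2,3)
proof (induction x arbitrary: y rule: less_induct)
  case (less x)
  show ?case
  proof (cases "x = 0")
    case True
    then show ?thesis by (simp add: laver_fin_0)
  next
    case False
    then have x: "x > 0" by simp
    have pred: "(v - 1) mod 2 ^ n = (if v mod 2 ^ n = 0 then 2 ^ n - 1 else v mod 2 ^ n - 1)"
      if "v > 0" for v :: nat
      using that by (cases v) (auto simp: mod_Suc)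
    have "y \<le> 2 ^ Suc n - 1" using less.prems by simp
    then show ?thesis
    proof (induction y rule: inc_induct)
      case base
      have "laver_fin (Suc n) x (2 ^ Suc n - 1) = x - 1" by (rule laver_fin_top [OF x])
      moreover have "(2 ^ Suc n - 1) mod 2 ^ n = (2 ^ n - 1 :: nat)"
        using pred [of "2 ^ Suc n"] by simp
      ultimately show ?case
        using pred [OF x] laver_fin_top [of "x mod 2 ^ n" n] by (auto simp: laver_fin_0)
    next
      case (step y)
      let ?u = "laver_fin (Suc n) x (Suc y)"
      have u: "?u < x" by (rule laver_fin_less [OF x])
      have sy: "Suc y < 2 ^ Suc n" using step by simp
      have "laver_fin (Suc n) x y mod 2 ^ n = laver_fin (Suc n) ?u (x - 1) mod 2 ^ n"
        using laver_fin_Suc [OF x sy] by simp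
      also have "\<dots> = laver_fin n (?u mod 2 ^ n) ((x - 1) mod 2 ^ n)"
        using less.IH [OF u] less.prems u by simp
      also have "?u mod 2 ^ n = laver_fin n (x mod 2 ^ n) (Suc y mod 2 ^ n)"
        using step by simp
      finally have eq: "laver_fin (Suc n) x y mod 2 ^ n =
        laver_fin n (laver_fin n (x mod 2 ^ n) (Suc y mod 2 ^ n)) ((x - 1) mod 2 ^ n)" .
      have y: "y mod 2 ^ n = (if Suc y mod 2 ^ n = 0 then 2 ^ n - 1 else Suc y mod 2 ^ n - 1)"
        using pred [of "Suc y"] by simp
      show ?case
      proof (cases "x mod 2 ^ n = 0")
        case True
        show ?thesis
          using eq y pred [OF x] True laver_fin_top [of "Suc y mod 2 ^ n" n]
          by (auto simp: laver_fin_0)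
      next
        case xn: False
        then have xp: "x mod 2 ^ n > 0" by simp
        show ?thesis
        proof (cases "Suc y mod 2 ^ n = 0")
          case True
          then show ?thesis
            using eq y pred [OF x] xn Z [OF xp] laver_fin_top [OF xp, of n]
            by (simp add: laver_fin_0)
        next
          case False
          then have "Suc (y mod 2 ^ n) = Suc y mod 2 ^ n" using y by simp
          moreover have "Suc y mod 2 ^ n < 2 ^ n" by simp
          ultimately show ?thesis
            using eq pred [OF x] xn laver_fin_Suc [OF xp, of "y mod 2 ^ n" n] by simp
        qed
      qed
    qed
  qed
qed

text \<open>Induction on \<open>n\<close>. For \<open>x > 2 ^ n\<close>, reduction leaves only the
  values \<open>0\<close> and \<open>2 ^ n\<close> at multiples of the period \<open>2 ^ k\<close>
  of \<open>x mod 2 ^ n\<close>. The value at the last such multiple decides whether the period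
  stays or doubles.\<close>

lemma laver_fin_zeros:
  assumes "0 < x" "x < 2 ^ n"
  shows "\<exists>k<n. \<forall>y<2 ^ n. laver_fin n x y = 0 \<longleftrightarrow> 2 ^ k dvd y"
  using assms
proof (induction n arbitrary: x)
  case 0
  then show ?case by simp
next
  case (Suc n)
  have Z: "laver_fin n x 0 = 0" if "0 < x" "x < 2 ^ n" for x
    using Suc.IH [OF that] by (metis dvd_0_right zero_less_numeral zero_less_power)
  note M = laver_fin_mod_step [OF Z]
  let ?f = "laver_fin (Suc n) x"
  have less: "?f y < x" for y using laver_fin_less Suc.prems by simp
  have Mx: "?f y mod 2 ^ n = laver_fin n (x mod 2 ^ n) (y mod 2 ^ n)" if "y < 2 ^ Suc n" for y
    using M [of x y] Suc.prems that by simp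
  consider "x < 2 ^ n" | "x = 2 ^ n" | "x > 2 ^ n" by linarith
  then show ?case
  proof cases
    case 1
    obtain k where k: "k < n" "\<forall>y<2 ^ n. laver_fin n x y = 0 \<longleftrightarrow> 2 ^ k dvd y"
      using Suc.IH [of x] Suc.prems 1 by auto
    have "?f y = 0 \<longleftrightarrow> 2 ^ k dvd y" if "y < 2 ^ Suc n" for y
    proof -
      have "?f y = laver_fin n x (y mod 2 ^ n)"
        using Mx [OF that] less [of y] 1 by simp
      moreover have "2 ^ k dvd (y mod 2 ^ n) \<longleftrightarrow> 2 ^ k dvd y"
        using k(1) by (intro dvd_mod_iff) (simp add: le_imp_power_dvd)
      ultimately show ?thesis using k(2) by simp
    qed
    then show ?thesis using k(1) less_SucI by blast
  next
    case 2
    have "?f y = 0 \<longleftrightarrow> 2 ^ n dvd y" if "y < 2 ^ Suc n" for y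
      using Mx [OF that] less [of y] 2 by (simp add: laver_fin_0 dvd_eq_mod_eq_0)
    then show ?thesis by blast
  next
    case 3
    let ?x = "x mod 2 ^ n"
    have x': "x = 2 ^ n + ?x"
      using 3 Suc.prems by (simp add: mod_if le_mod_geq)
    then have "0 < ?x" using 3 by linarith
    moreover have "?x < 2 ^ n" by simp
    ultimately obtain k where k: "k < n" "\<forall>y<2 ^ n. laver_fin n ?x y = 0 \<longleftrightarrow> 2 ^ k dvd y"
      using Suc.IH by blast
    have fz: "?f y mod 2 ^ n = 0 \<longleftrightarrow> 2 ^ k dvd y" if "y < 2 ^ Suc n" for y
    proof -
      have "2 ^ k dvd (y mod 2 ^ n) \<longleftrightarrow> 2 ^ k dvd y"
        using k(1) by (intro dvd_mod_iff) (simp add: le_imp_power_dvd)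
      then show ?thesis using Mx [OF that] k(2) by simp
    qed
    have x: "x > 0" using Suc.prems by simp
    have "2 ^ k \<le> (2::nat) ^ n" using k(1) by simp
    then have kn: "2 ^ k + 2 ^ k \<le> (2::nat) ^ Suc n" unfolding power_Suc by linarith
    show ?thesis
    proof (cases "?f (2 ^ Suc n - 2 ^ k) = 0")
      case True
      have "?f y = 0 \<longleftrightarrow> 2 ^ k dvd y" if "y < 2 ^ Suc n" for y
        using fz [OF that] laver_fin_zero_multiples [OF x True _ that] k(1) by auto
      then show ?thesis using k(1) less_SucI by blast
    next
      case False
      have dk: "2 ^ k dvd 2 ^ Suc n - (2::nat) ^ k"
        using k(1) by (intro dvd_diff_nat) (auto simp: le_imp_power_dvd)
      \<comment> \<open>Walking left from the value \<open>2 ^ n\<close>, the row strictly falls,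
        since the arguments strictly between two neighbouring multiples of \<open>2 ^ k\<close> have
        nonzero values.\<close>
      have below: "?f (2 ^ Suc n - 2 ^ k - Suc r) < 2 ^ n" if "r < 2 ^ k" for r
        using that
      proof (induction r)
        case 0
        have "?f (2 ^ Suc n - 2 ^ k) < 2 ^ Suc n" using less Suc.prems by (meson less_trans)
        moreover have "2 ^ n dvd ?f (2 ^ Suc n - 2 ^ k)"
          using fz [of "2 ^ Suc n - 2 ^ k"] dk by (simp add: dvd_eq_mod_eq_0)
        then obtain q where q: "?f (2 ^ Suc n - 2 ^ k) = 2 ^ n * q" ..
        ultimately have "q < 2" "q > 0" using False by (auto intro: gr0I)
        then have "?f (2 ^ Suc n - 2 ^ k) = 2 ^ n" using q by (simp add: less_2_cases_iff)
        moreover have "Suc (2 ^ Suc n - 2 ^ k - Suc 0) = 2 ^ Suc n - (2::nat) ^ k"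
          using k(1) by (subst Suc_diff_Suc) (simp_all del: power_Suc)
        ultimately show ?case
          using laver_fin_mono [OF x, of "2 ^ Suc n - 2 ^ k - Suc 0" "Suc n"] by simp
      next
        case (Suc r)
        let ?y = "2 ^ Suc n - 2 ^ k - Suc (Suc r)"
        have y: "Suc ?y = 2 ^ Suc n - 2 ^ k - Suc r"
          using kn Suc.prems by linarith
        have "\<not> 2 ^ k dvd 2 ^ Suc n - 2 ^ k - Suc r"
        proof
          assume "2 ^ k dvd 2 ^ Suc n - 2 ^ k - Suc r"
          then have "2 ^ k dvd (2 ^ Suc n - 2 ^ k) - (2 ^ Suc n - 2 ^ k - Suc r)"
            using dk by (rule dvd_diff_nat [rotated])
          moreover have "(2 ^ Suc n - 2 ^ k) - (2 ^ Suc n - 2 ^ k - Suc r) = Suc r"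
            using kn Suc.prems by linarith
          ultimately show False using Suc.prems by (simp add: nat_dvd_not_less)
        qed
        then have "?f (Suc ?y) > 0"
          using fz [of "Suc ?y"] y by (intro gr0I) auto
        then have "?f ?y < ?f (Suc ?y)"
          using laver_fin_mono [OF x, of ?y "Suc n"] y by simp
        then show ?case using Suc y by simp
      qed
      have "?f (2 ^ Suc n - 2 ^ k - Suc (2 ^ k - 1)) < 2 ^ n" by (rule below) simp
      then have "?f (2 ^ Suc n - 2 ^ Suc k) < 2 ^ n" by (simp add: mult_2)
      moreover have "2 ^ k dvd 2 ^ Suc n - (2::nat) ^ Suc k"
        using k(1) by (intro dvd_diff_nat) (auto simp: le_imp_power_dvd)
      ultimately have zero: "?f (2 ^ Suc n - 2 ^ Suc k) = 0"
        using fz [of "2 ^ Suc n - 2 ^ Suc k"] by simp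
      have "?f y = 0 \<longleftrightarrow> 2 ^ Suc k dvd y" if y: "y < 2 ^ Suc n" for y
      proof
        assume "2 ^ Suc k dvd y"
        then show "?f y = 0" using laver_fin_zero_multiples [OF x zero _ y] k(1) by simp
      next
        assume f0: "?f y = 0"
        show "2 ^ Suc k dvd y"
        proof (rule ccontr)
          assume nd: "\<not> 2 ^ Suc k dvd y"
          have "2 ^ k dvd y" using fz [OF y] f0 by simp
          then obtain i where i: "y = 2 ^ k * i" ..
          with nd have "odd i" by auto
          then obtain h where h: "i = 2 * h + 1" by (rule oddE)
          \<comment> \<open>An odd multiple of \<open>2 ^ k\<close> lies \<open>2 ^ k\<close> below
            a zero or below the end of the row, so it takes the nonzero value found at
            \<open>2 ^ Suc n - 2 ^ k\<close>.\<close>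
          show False
          proof (cases "y + 2 ^ k < 2 ^ Suc n")
            case True
            have "2 ^ Suc k dvd y + 2 ^ k" using i h by (simp add: algebra_simps)
            then have "?f (y + 2 ^ k) = 0"
              using laver_fin_zero_multiples [OF x zero _ True] k(1) by simp
            then have "?f (y + 2 ^ k - 2 ^ k) = ?f (2 ^ Suc n - 2 ^ k)"
              by (intro laver_fin_reset [OF x True]) auto
            then show False using f0 False by simp
          next
            case ge: False
            have "2 ^ Suc n = 2 ^ k * (2 ^ (Suc n - k) :: nat)"
              using k(1) by (simp flip: power_add)
            moreover from this have "2 ^ k * i < 2 ^ k * (2 ^ (Suc n - k) :: nat)"
              "2 ^ k * (2 ^ (Suc n - k) :: nat) \<le> 2 ^ k * (i + 1)"
              using ge y i by simp_all
            then have "2 ^ (Suc n - k) = i + 1"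
              unfolding mult_less_cancel1 mult_le_cancel1 by simp
            ultimately have "y = 2 ^ Suc n - 2 ^ k" using i by simp
            then show False using f0 False by simp
          qed
        qed
      qed
      then show ?thesis using k(1) by (intro exI [of _ "Suc k"]) auto
    qed
  qed
qed

section \<open>Reduction homomorphisms between the finite algebras\<close>

lemma laver_fin_mod_Suc:
  assumes "x < 2 ^ Suc n" "y < 2 ^ Suc n"
  shows "laver_fin (Suc n) x y mod 2 ^ n = laver_fin n (x mod 2 ^ n) (y mod 2 ^ n)"
proof (rule laver_fin_mod_step [OF _ assms])
  show "laver_fin n x 0 = 0" if "0 < x" "x < 2 ^ n" for x
    using laver_fin_zeros [OF that] by (metis dvd_0_right zero_less_numeral zero_less_power)
qed

lemma laver_fin_bound:
  assumes "x < 2 ^ n" "y < 2 ^ n"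
  shows "laver_fin n x y < 2 ^ n"
  using assms laver_fin_less [of x n y] by (cases "x = 0") (auto simp: laver_fin_0)

lemma laver_fin_mod:
  assumes "x < 2 ^ (n + j)" "y < 2 ^ (n + j)"
  shows "laver_fin (n + j) x y mod 2 ^ n = laver_fin n (x mod 2 ^ n) (y mod 2 ^ n)"
  using assms
proof (induction j arbitrary: x y)
  case 0
  then show ?case by (simp add: laver_fin_bound)
next
  case (Suc j)
  have dvd: "2 ^ n dvd (2::nat) ^ (n + j)" by (simp add: le_imp_power_dvd)
  have "laver_fin (n + Suc j) x y mod 2 ^ n = (laver_fin (n + Suc j) x y mod 2 ^ (n + j)) mod 2 ^ n"
    using dvd by (simp add: mod_mod_cancel)
  also have "laver_fin (n + Suc j) x y mod 2 ^ (n + j) =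
      laver_fin (n + j) (x mod 2 ^ (n + j)) (y mod 2 ^ (n + j))"
    using laver_fin_mod_Suc [of x "n + j" y] Suc.prems by simp
  also have "\<dots> mod 2 ^ n = laver_fin n (x mod 2 ^ (n + j) mod 2 ^ n) (y mod 2 ^ (n + j) mod 2 ^ n)"
    by (rule Suc.IH) auto
  finally show ?case using dvd by (simp add: mod_mod_cancel)
qed

text \<open>For \<open>x > 0\<close> values lie below \<open>x\<close>, so reducing them modulo
  \<open>2 ^ n\<close> changes nothing. This frees \<open>laver\<close> from its choice of
  \<open>N\<close>.\<close>

lemma laver_fin_stable:
  assumes "x < 2 ^ n" "y < 2 ^ n"
  shows "laver_fin (n + j) x y = laver_fin n x y"
proof (cases "x = 0")
  case False
  have "2 ^ n \<le> (2::nat) ^ (n + j)" by simp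
  then have "x < 2 ^ (n + j)" "y < 2 ^ (n + j)" using assms by linarith+
  moreover have "laver_fin (n + j) x y < 2 ^ n"
    using False assms(1) laver_fin_less [of x "n + j" y] by simp
  ultimately show ?thesis using laver_fin_mod [of x n j y] assms by simp
qed (simp add: laver_fin_0)

section \<open>The infinite algebra\<close>

lemma laver_eq:
  assumes "x < 2 ^ n" "y < 2 ^ n"
  shows "x \<rhd> y = laver_fin n x y"
proof -
  let ?P = "\<lambda>N. x < 2 ^ N \<and> y < 2 ^ N"
  have "?P (LEAST N. ?P N)" using assms by (intro LeastI [of ?P n]) simp
  moreover have "(LEAST N. ?P N) \<le> n" using assms by (intro Least_le) simp
  ultimately show ?thesis
    unfolding laver_def using laver_fin_stable [of x "LEAST N. ?P N" y "n - (LEAST N. ?P N)"] by simp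
qed

lemma less_two_power_add: "(x::nat) < 2 ^ (x + y)" "(y::nat) < 2 ^ (x + y)"
  by (metis less_exp less_le_trans le_add1 le_add2 one_le_numeral power_increasing)+

lemma laver_0_left [simp]: "0 \<rhd> y = y"
  using laver_eq [OF less_two_power_add, of 0 y] by (simp add: laver_fin_0)

lemma laver_less: "x > 0 \<Longrightarrow> x \<rhd> y < x"
  using laver_eq [OF less_two_power_add] laver_fin_less by simp

lemma laver_top: "0 < x \<Longrightarrow> x < 2 ^ n \<Longrightarrow> x \<rhd> (2 ^ n - 1) = x - 1"
  using laver_eq [of x n "2 ^ n - 1"] laver_fin_top by simp

lemma laver_rec:
  assumes "x > 0"
  shows "x \<rhd> y = (x \<rhd> Suc y) \<rhd> (x - 1)"
proof -
  let ?N = "x + Suc y"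
  have b: "x < 2 ^ ?N" "Suc y < 2 ^ ?N" by (rule less_two_power_add)+
  moreover have "x \<rhd> Suc y < 2 ^ ?N" using laver_less [OF assms] b by (meson less_trans)
  ultimately show ?thesis
    using laver_fin_Suc [OF assms b(2)] laver_eq [of _ ?N] by simp
qed

lemma laver_mod: "(x \<rhd> y) mod 2 ^ n = (x mod 2 ^ n) \<rhd> (y mod 2 ^ n)"
proof -
  have "x < 2 ^ (n + (x + y))" "y < 2 ^ (n + (x + y))"
    using less_two_power_add [of x "n + y"] less_two_power_add [of "n + x" y] less_two_power_add [of y "n + x"]
    by (simp_all add: algebra_simps)
  then show ?thesis
    using laver_fin_mod [of x n "x + y" y] laver_eq [of "x mod 2 ^ n" n "y mod 2 ^ n"]
      laver_eq [of x "n + (x + y)" y] by simp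
qed

lemma laver_mod_right: "0 < x \<Longrightarrow> x < 2 ^ n \<Longrightarrow> x \<rhd> (y mod 2 ^ n) = x \<rhd> y"
  using laver_mod [of x y n] laver_less [of x y] by simp

lemma laver_zeros:
  assumes "x > 0"
  shows "\<exists>k. \<forall>y. x \<rhd> y = 0 \<longleftrightarrow> 2 ^ k dvd y"
proof -
  have x: "x < 2 ^ x" by simp
  obtain k where k: "k < x" "\<forall>y<2 ^ x. laver_fin x x y = 0 \<longleftrightarrow> 2 ^ k dvd y"
    using laver_fin_zeros [OF assms x] by blast
  have "x \<rhd> y = 0 \<longleftrightarrow> 2 ^ k dvd y" for y
  proof -
    have "x \<rhd> y = laver_fin x x (y mod 2 ^ x)"
      using laver_mod_right [OF assms x, of y] laver_eq [of x x "y mod 2 ^ x"] by simp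
    moreover have "2 ^ k dvd (y mod 2 ^ x) \<longleftrightarrow> 2 ^ k dvd y"
      using k(1) by (intro dvd_mod_iff) (simp add: le_imp_power_dvd)
    ultimately show ?thesis using k(2) by simp
  qed
  then show ?thesis by blast
qed

lemma laver_pow2 [simp]: "2 ^ n \<rhd> y = y mod 2 ^ n"
  using laver_mod [of "2 ^ n" y n] laver_less [of "2 ^ n" y] by simp

text \<open>A row is determined by its value at a large \<open>2 ^ N - 1\<close>.\<close>

lemma laver_descend:
  fixes B :: nat
  assumes top: "\<And>N. B < 2 ^ N \<Longrightarrow> P (2 ^ N - 1)"
    and step: "\<And>y. P (Suc y) \<Longrightarrow> P y"
  shows "P y"
proof -
  have b: "B < 2 ^ (B + y)" "y < 2 ^ (B + y)" by (rule less_two_power_add)+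
  have "y \<le> 2 ^ (B + y) - 1" using b by simp
  then show ?thesis
  proof (induction rule: inc_induct)
    case base
    show ?case by (rule top [OF b(1)])
  next
    case (step y)
    show ?case by (rule assms(2) [OF step.IH])
  qed
qed

section \<open>Left distributivity and composition of translations\<close>

lemma laver_distrib: "x \<rhd> (y \<rhd> z) = (x \<rhd> y) \<rhd> (x \<rhd> z)"
proof (induction x arbitrary: y z rule: less_induct)
  case x: (less x)
  show ?case
  proof (cases "x = 0")
    case False
    then have x0: "x > 0" by simp
    show ?thesis
    proof (induction y arbitrary: z rule: less_induct)
      case y: (less y)
      show ?case
      proof (cases "y = 0")
        case True
        have "x \<rhd> 0 = 0" using laver_zeros [OF x0] by auto
        then show ?thesis using True by simp
      next
        case False
        then have y0: "y > 0" by simp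
        show ?thesis
        proof (rule laver_descend [where y = z and B = "x + y"])
          fix N assume N: "x + y < 2 ^ N"
          then have "y \<rhd> (2 ^ N - 1) = y - 1" "x \<rhd> (2 ^ N - 1) = x - 1"
            using laver_top x0 y0 by auto
          then show "x \<rhd> (y \<rhd> (2 ^ N - 1)) = (x \<rhd> y) \<rhd> (x \<rhd> (2 ^ N - 1))"
            using laver_rec [OF x0, of "y - 1"] y0 by simp
        next
          fix z assume IH: "x \<rhd> (y \<rhd> Suc z) = (x \<rhd> y) \<rhd> (x \<rhd> Suc z)"
          \<comment> \<open>After expanding by the recursion for \<open>y\<close>, the inner
            induction applies since \<open>y \<rhd> Suc z < y\<close>, and the outer one since
            \<open>x \<rhd> Suc z < x\<close>.\<close>
          have "x \<rhd> (y \<rhd> z) = x \<rhd> ((y \<rhd> Suc z) \<rhd> (y - 1))"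
            using laver_rec [OF y0, of z] by simp
          also have "\<dots> = ((x \<rhd> y) \<rhd> (x \<rhd> Suc z)) \<rhd> (x \<rhd> (y - 1))"
            using y.IH [OF laver_less [OF y0]] IH by simp
          also have "x \<rhd> (y - 1) = (x \<rhd> y) \<rhd> (x - 1)"
            using laver_rec [OF x0, of "y - 1"] y0 by simp
          also have "((x \<rhd> y) \<rhd> (x \<rhd> Suc z)) \<rhd> \<dots> = (x \<rhd> y) \<rhd> ((x \<rhd> Suc z) \<rhd> (x - 1))"
            using x.IH [OF laver_less [OF x0]] by simp
          also have "(x \<rhd> Suc z) \<rhd> (x - 1) = x \<rhd> z"
            using laver_rec [OF x0, of z] by simp
          finally show "x \<rhd> (y \<rhd> z) = (x \<rhd> y) \<rhd> (x \<rhd> z)" .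
        qed
      qed
    qed
  qed simp
qed

text \<open>By distributivity both sides obey the same downward recursion, and both start from
  \<open>x \<rhd> w\<close> at large \<open>2 ^ N - 1\<close>.\<close>

lemma laver_comp: "(x \<rhd> w + 1) \<rhd> y = x \<rhd> ((w + 1) \<rhd> y)"
proof (rule laver_descend [where y = y and B = "w + x \<rhd> w + 1"])
  fix N assume N: "w + x \<rhd> w + 1 < 2 ^ N"
  then show "(x \<rhd> w + 1) \<rhd> (2 ^ N - 1) = x \<rhd> ((w + 1) \<rhd> (2 ^ N - 1))"
    using laver_top [of "w + 1" N] laver_top [of "x \<rhd> w + 1" N] by simp
next
  fix y assume IH: "(x \<rhd> w + 1) \<rhd> Suc y = x \<rhd> ((w + 1) \<rhd> Suc y)"
  have "(x \<rhd> w + 1) \<rhd> y = (x \<rhd> ((w + 1) \<rhd> Suc y)) \<rhd> (x \<rhd> w)"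
    using laver_rec [of "x \<rhd> w + 1" y] IH by simp
  also have "\<dots> = x \<rhd> (((w + 1) \<rhd> Suc y) \<rhd> w)" using laver_distrib by simp
  also have "\<dots> = x \<rhd> ((w + 1) \<rhd> y)" using laver_rec [of "w + 1" y] by simp
  finally show "(x \<rhd> w + 1) \<rhd> y = x \<rhd> ((w + 1) \<rhd> y)" .
qed

section \<open>Zeros, periods and growth of rows\<close>

lemma laver_mono_Suc: "x > 0 \<Longrightarrow> x \<rhd> Suc y > 0 \<Longrightarrow> x \<rhd> y < x \<rhd> Suc y"
  using laver_rec [of x y] laver_less [of "x \<rhd> Suc y" "x - 1"] by simp

lemma laver_0_right [simp]: "x \<rhd> 0 = 0"
  using laver_zeros [of x] by (cases "x = 0") auto

lemma laver_zero_mult: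
  assumes "x \<rhd> p = 0" "p dvd y"
  shows "x \<rhd> y = 0"
proof (cases "x = 0")
  case False
  then obtain k where "\<forall>y. x \<rhd> y = 0 \<longleftrightarrow> 2 ^ k dvd y" using laver_zeros [of x] by auto
  then show ?thesis using assms by (meson dvd_trans)
qed (use assms in simp)

lemma laver_zero_odd:
  assumes "x \<rhd> (2 ^ k * c) = 0" "odd c" "x > 0"
  shows "x \<rhd> 2 ^ k = 0"
proof -
  obtain j where j: "\<forall>y. x \<rhd> y = 0 \<longleftrightarrow> 2 ^ j dvd y" using laver_zeros [OF assms(3)] by auto
  then have "2 ^ j dvd 2 ^ k * c" using assms(1) by simp
  moreover have "coprime (2 ^ j) c" using assms(2) by simp
  ultimately show ?thesis using j by (simp add: coprime_dvd_mult_left_iff)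
qed

lemma laver_add_period:
  assumes "x \<rhd> p = 0"
  shows "x \<rhd> (y + p) = x \<rhd> y"
proof (cases "x = 0")
  case False
  then have x: "x > 0" by simp
  show ?thesis
  proof (rule laver_descend [where y = y and B = x])
    fix N assume N: "x < 2 ^ N"
    then have "x \<rhd> 2 ^ N = 0" using laver_mod_right [OF x N, of "2 ^ N"] by simp
    then have "x \<rhd> (2 ^ N + p) = 0"
      using assms laver_zeros [OF x] by (metis dvd_add)
    then have "x \<rhd> (2 ^ N - 1 + p) = x - 1"
      using laver_rec [OF x, of "2 ^ N - 1 + p"] by simp
    then show "x \<rhd> (2 ^ N - 1 + p) = x \<rhd> (2 ^ N - 1)" using laver_top [OF x N] by simp
  next
    fix y assume "x \<rhd> (Suc y + p) = x \<rhd> Suc y"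
    then show "x \<rhd> (y + p) = x \<rhd> y" using laver_rec [OF x, of y] laver_rec [OF x, of "y + p"] by simp
  qed
qed (use assms in simp)

lemma laver_add_period_mult:
  assumes "x \<rhd> p = 0" "p dvd q"
  shows "x \<rhd> (q + y) = x \<rhd> y"
  using laver_add_period [OF laver_zero_mult [OF assms], of y] by (simp add: add.commute)

lemma laver_mod_period:
  assumes "x \<rhd> p = 0"
  shows "x \<rhd> (y mod p) = x \<rhd> y"
  using laver_add_period_mult [OF assms, of "p * (y div p)" "y mod p"] by simp

lemma laver_below_zero:
  assumes "x > 0" "x \<rhd> p = 0" "p > 0"
  shows "x \<rhd> (p - 1) = x - 1"
  using laver_rec [OF assms(1), of "p - 1"] assms by simp

lemma laver_mono:
  assumes "x > 0" "\<And>i. y < i \<Longrightarrow> i \<le> z \<Longrightarrow> x \<rhd> i > 0" "y \<le> z"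
  shows "x \<rhd> y + (z - y) \<le> x \<rhd> z"
  using assms(3,2)
proof (induction z rule: dec_induct)
  case base
  then show ?case by simp
next
  case (step z)
  then have "x \<rhd> z < x \<rhd> Suc z" by (intro laver_mono_Suc assms) auto
  moreover have "x \<rhd> y + (z - y) \<le> x \<rhd> z" using step by auto
  ultimately show ?case using step by simp
qed

text \<open>Modulo \<open>2 ^ e\<close> the row vanishes at \<open>2 ^ k\<close>, hence at all
  multiples of it. Before the first positive zero the values at these multiples increase strictly,
  so by at least \<open>2 ^ e\<close> each time, and \<open>z < 2 ^ (e + r)\<close> leaves room for
  fewer than \<open>2 ^ r\<close> increases.\<close>

lemma laver_period_growth:
  assumes "0 < z" "z < 2 ^ (e + r)" "2 ^ e dvd z \<rhd> 2 ^ k"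
  shows "z \<rhd> 2 ^ (k + r) = 0"
proof -
  note z = assms(1)
  obtain j where j: "\<forall>y. z \<rhd> y = 0 \<longleftrightarrow> 2 ^ j dvd y" using laver_zeros [OF z] by auto
  show ?thesis
  proof (cases "j \<le> k + r")
    case True
    then show ?thesis using j by (simp add: le_imp_power_dvd)
  next
    case False
    have dvd: "2 ^ e dvd z \<rhd> (2 ^ k * i)" for i
    proof -
      have "(z \<rhd> 2 ^ k) mod 2 ^ e = 0" using assms(3) by simp
      then have *: "(z mod 2 ^ e) \<rhd> (2 ^ k mod 2 ^ e) = 0" using laver_mod by simp
      have "(z mod 2 ^ e) \<rhd> ((2 ^ k * i) mod 2 ^ e) = 0"
      proof (cases "z mod 2 ^ e = 0")
        case True
        then have "2 ^ e dvd (2::nat) ^ k" using * by (simp add: dvd_eq_mod_eq_0)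
        then show ?thesis using True by simp
      next
        case False
        have "(z mod 2 ^ e) \<rhd> 2 ^ k = 0"
          using * laver_mod_right [of "z mod 2 ^ e" e "2 ^ k"] False by simp
        then have "(z mod 2 ^ e) \<rhd> (2 ^ k * i) = 0" by (rule laver_zero_mult) simp
        then show ?thesis
          using laver_mod_right [of "z mod 2 ^ e" e "2 ^ k * i"] False by simp
      qed
      then have "(z \<rhd> (2 ^ k * i)) mod 2 ^ e = 0" using laver_mod by simp
      then show ?thesis by (simp add: dvd_eq_mod_eq_0)
    qed
    have "2 ^ e * i \<le> z \<rhd> (2 ^ k * i)" if "i \<le> 2 ^ r" for i
      using that
    proof (induction i)
      case (Suc i)
      have "z \<rhd> s > 0" if "0 < s" "s \<le> 2 ^ k * Suc i" for s
      proof (rule ccontr)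
        assume "\<not> 0 < z \<rhd> s"
        then have "2 ^ j \<le> s" using j that by (auto dest: dvd_imp_le)
        also have "s \<le> 2 ^ k * 2 ^ r" using that Suc.prems by (meson le_trans mult_le_mono2)
        also have "\<dots> < 2 ^ j" using False by (simp flip: power_add)
        finally show False by simp
      qed
      then have "z \<rhd> (2 ^ k * i) + (2 ^ k * Suc i - 2 ^ k * i) \<le> z \<rhd> (2 ^ k * Suc i)"
        using z by (intro laver_mono) auto
      moreover have "2 ^ k * i < 2 ^ k * Suc i" by simp
      ultimately have "z \<rhd> (2 ^ k * i) < z \<rhd> (2 ^ k * Suc i)" by linarith
      moreover obtain a b where ab: "z \<rhd> (2 ^ k * i) = 2 ^ e * a" "z \<rhd> (2 ^ k * Suc i) = 2 ^ e * b"
        using dvd by (meson dvdE)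
      ultimately have "a < b" by simp
      moreover have "i \<le> a" using Suc ab(1) by simp
      ultimately have "Suc i \<le> b" by simp
      then have "2 ^ e * Suc i \<le> 2 ^ e * b" by (rule mult_le_mono2)
      then show ?case by (simp only: ab)
    qed simp
    from this [of "2 ^ r"] have "2 ^ (e + r) \<le> z \<rhd> (2 ^ k * 2 ^ r)" by (simp add: power_add)
    moreover have "z \<rhd> (2 ^ k * 2 ^ r) < 2 ^ (e + r)"
      using laver_less [OF z] assms(2) by (rule less_trans)
    ultimately show ?thesis by linarith
  qed
qed

lemma two_power_times_odd:
  assumes "0 < (w::nat)"
  obtains i c where "w = 2 ^ i * c" "odd c"
proof -
  have "\<exists>i c. w = 2 ^ i * c \<and> odd c"
    using assms
  proof (induction w rule: less_induct)
    case (less w)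
    show ?case
    proof (cases "odd w")
      case True
      then show ?thesis by (intro exI [of _ 0] exI [of _ w]) simp
    next
      case False
      then obtain v where v: "w = 2 * v" by blast
      then obtain i c where "v = 2 ^ i * c" "odd c" using less.IH [of v] less.prems by auto
      then show ?thesis using v by (intro exI [of _ "Suc i"] exI [of _ c]) simp
    qed
  qed
  then show thesis using that by blast
qed

text \<open>For \<open>w = 2 ^ i * c\<close> with \<open>c\<close> odd, \<open>w\<close> is
  \<open>2 ^ i\<close> modulo \<open>2 ^ Suc i\<close>, and \<open>2 ^ i \<rhd> 2 ^ i = 0\<close>.
  So \<open>2 ^ Suc i\<close> divides \<open>w \<rhd> 2 ^ i\<close>, and
  \<open>laver_period_growth\<close> bounds the period.\<close>

lemma laver_half_period:
  assumes "0 < w" "w < 2 ^ Suc n"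
  shows "w \<rhd> 2 ^ n = 0"
proof -
  obtain i c where c: "w = 2 ^ i * c" "odd c" using two_power_times_odd [OF assms(1)] .
  then have "2 ^ i \<le> w" by (cases c) auto
  then have "2 ^ i < (2::nat) ^ Suc n" using assms(2) by simp
  then have i: "i \<le> n" by (simp del: power_Suc)
  obtain b where "c = 2 * b + 1" using c(2) by (rule oddE)
  then have "w = 2 ^ i + 2 ^ Suc i * b" using c(1) by (simp add: algebra_simps)
  then have "w mod 2 ^ Suc i = 2 ^ i mod 2 ^ Suc i" by (simp only: mod_mult_self2)
  moreover have "2 ^ i mod 2 ^ Suc i = (2::nat) ^ i" by simp
  ultimately have "w mod 2 ^ Suc i = 2 ^ i" by (rule trans)
  then have "(w \<rhd> 2 ^ i) mod 2 ^ Suc i = 2 ^ i \<rhd> 2 ^ i"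
    by (simp only: laver_mod \<open>2 ^ i mod 2 ^ Suc i = (2::nat) ^ i\<close>)
  also have "\<dots> = 0" by simp
  finally have "2 ^ Suc i dvd w \<rhd> 2 ^ i" by (rule mod_0_imp_dvd)
  moreover have "Suc i + (n - i) = Suc n" "i + (n - i) = n" using i by simp_all
  ultimately show ?thesis
    using laver_period_growth [OF assms(1), of "Suc i" "n - i" i] assms(2) by metis
qed

section \<open>Scaling and blocks\<close>

definition scales :: "nat \<Rightarrow> nat \<Rightarrow> bool" where
  "scales d b \<longleftrightarrow> (\<forall>u v. u < 2 ^ b \<longrightarrow> (2 ^ d * u) \<rhd> (2 ^ d * v) = 2 ^ d * (u \<rhd> v))"

definition collapses :: "nat \<Rightarrow> nat \<Rightarrow> bool" where
  "collapses d b \<longleftrightarrow> (\<forall>z<2 ^ (d + b). \<not> 2 ^ d dvd z \<longrightarrow> z \<rhd> 2 ^ d = 0)"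

definition block_map :: "nat \<Rightarrow> nat \<Rightarrow> nat \<Rightarrow> nat" where
  "block_map d x i = (x + 1) \<rhd> (i div 2 ^ d) + i mod 2 ^ d"

text \<open>The condition at \<open>2 ^ b\<close> says that the period of \<open>x + 1\<close>
  divides \<open>2 ^ b\<close>; it makes \<open>block_map d x\<close> commute with adding
  \<open>2 ^ (d + b)\<close> to the argument in the sense that its value is unchanged.\<close>

definition blocks :: "nat \<Rightarrow> nat \<Rightarrow> bool" where
  "blocks d b \<longleftrightarrow> (\<forall>x i. 2 ^ d dvd x \<longrightarrow> (x + 1) \<rhd> 2 ^ b = 0 \<longrightarrow> (x + 2 ^ d) \<rhd> i = block_map d x i)"

lemma laver_mod_dvd: "2 ^ d dvd x \<Longrightarrow> (x \<rhd> i) mod 2 ^ d = i mod 2 ^ d"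
  by (simp add: laver_mod dvd_eq_mod_eq_0)

lemma laver_pos_in_block: "2 ^ d dvd x \<Longrightarrow> \<not> 2 ^ d dvd i \<Longrightarrow> x \<rhd> i > 0"
  using laver_mod_dvd [of d x i] by (intro gr0I) (simp add: dvd_eq_mod_eq_0)

lemma not_dvd_block: "c * w < i \<Longrightarrow> i < c * w + c \<Longrightarrow> \<not> c dvd (i::nat)"
proof
  assume "c * w < i" "i < c * w + c" "c dvd i"
  then obtain k where "i = c * k" by blast
  then have "c * w < c * k" "c * k < c * Suc w"
    using \<open>c * w < i\<close> \<open>i < c * w + c\<close> by simp_all
  then have "w < k" "k < Suc w" unfolding mult_less_cancel1 by simp_all
  then show False by simp
qed

text \<open>Values are congruent to the arguments modulo \<open>2 ^ d\<close>, so no zero occurs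
  strictly inside a block and the row rises by at least one per step.\<close>

lemma laver_block_ge:
  assumes "2 ^ d dvd x" "x > 0" "y < 2 ^ d" "s \<le> y"
  shows "x \<rhd> (2 ^ d * w + s) + (y - s) \<le> x \<rhd> (2 ^ d * w + y)"
proof -
  have "x \<rhd> i > 0" if "2 ^ d * w + s < i" "i \<le> 2 ^ d * w + y" for i
    using not_dvd_block [of "2 ^ d" w i] that assms by (intro laver_pos_in_block) auto
  then show ?thesis
    using laver_mono [OF assms(2), of "2 ^ d * w + s" "2 ^ d * w + y"] assms by simp
qed

text \<open>The values at the two ends of a block differ by exactly \<open>2 ^ d - 1\<close>, so a
  row that rises at every step must rise by one each time.\<close>

lemma scales_block:
  assumes "scales d b" "u < 2 ^ b" "y < 2 ^ d"
  shows "(2 ^ d * u) \<rhd> (2 ^ d * w + y) = 2 ^ d * (u \<rhd> w) + y"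
proof (cases "u = 0")
  case False
  have sc: "(2 ^ d * u) \<rhd> (2 ^ d * v) = 2 ^ d * (u \<rhd> v)" if "u < 2 ^ b" for u v
    using assms(1) that unfolding scales_def by blast
  \<comment> \<open>The recursion reaches the end of a block from the start of the next one. As
    \<open>2 ^ d * u - 1\<close> is again the end of a block, induction on \<open>u\<close>
    applies.\<close>
  have top: "(2 ^ d * u) \<rhd> (2 ^ d * w + (2 ^ d - 1)) = 2 ^ d * (u \<rhd> w) + (2 ^ d - 1)"
    if "u < 2 ^ b" for u w
    using that
  proof (induction u arbitrary: w rule: less_induct)
    case (less u)
    show ?case
    proof (cases "u = 0")
      case False
      let ?v = "u \<rhd> Suc w"
      have v: "?v < u" using False laver_less by simp
      have last: "2 ^ d * u - 1 = 2 ^ d * (u - 1) + (2 ^ d - 1)"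
        using False by (cases u) auto
      have "(2 ^ d * u) \<rhd> (2 ^ d * w + (2 ^ d - 1)) =
          ((2 ^ d * u) \<rhd> (2 ^ d * Suc w)) \<rhd> (2 ^ d * u - 1)"
        using laver_rec [of "2 ^ d * u" "2 ^ d * w + (2 ^ d - 1)"] False by (simp add: algebra_simps)
      also have "\<dots> = (2 ^ d * ?v) \<rhd> (2 ^ d * (u - 1) + (2 ^ d - 1))"
        unfolding sc [OF less.prems] last ..
      also have "\<dots> = 2 ^ d * (?v \<rhd> (u - 1)) + (2 ^ d - 1)"
        by (rule less.IH) (use v less.prems in simp_all)
      also have "?v \<rhd> (u - 1) = u \<rhd> w" using laver_rec [of u w] False by simp
      finally show ?thesis .
    qed simp
  qed
  have d: "2 ^ d dvd 2 ^ d * u" "2 ^ d * u > 0" using False by simp_all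
  have "2 ^ d * (u \<rhd> w) + y \<le> (2 ^ d * u) \<rhd> (2 ^ d * w + y)"
    using laver_block_ge [OF d assms(3), of 0 w] sc [OF assms(2)] by simp
  moreover have "(2 ^ d * u) \<rhd> (2 ^ d * w + y) + (2 ^ d - 1 - y) \<le> 2 ^ d * (u \<rhd> w) + (2 ^ d - 1)"
    using laver_block_ge [OF d, of "2 ^ d - 1" y w] top [OF assms(2)] assms(3) by simp
  ultimately show ?thesis using assms(3) by linarith
qed simp

text \<open>Descending the row, every value is \<open>2 ^ d * v\<close> with some
  \<open>v \<le> u\<close>, so each step of the recursion stays within the assumed cases.\<close>

lemma scales_row:
  assumes "\<And>v w. v \<le> u \<Longrightarrow> (2 ^ d * v) \<rhd> (2 ^ d * w) = 2 ^ d * (v \<rhd> w)"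
  shows "(2 ^ d * u + 1) \<rhd> i = 2 ^ d * ((u + 1) \<rhd> i)"
proof (rule laver_descend [where y = i and B = "2 ^ d * u + 1 + u"])
  fix N assume N: "2 ^ d * u + 1 + u < 2 ^ N"
  then show "(2 ^ d * u + 1) \<rhd> (2 ^ N - 1) = 2 ^ d * ((u + 1) \<rhd> (2 ^ N - 1))"
    using laver_top [of "2 ^ d * u + 1" N] laver_top [of "u + 1" N] by simp
next
  fix i assume IH: "(2 ^ d * u + 1) \<rhd> Suc i = 2 ^ d * ((u + 1) \<rhd> Suc i)"
  have "(2 ^ d * u + 1) \<rhd> i = (2 ^ d * ((u + 1) \<rhd> Suc i)) \<rhd> (2 ^ d * u)"
    using laver_rec [of "2 ^ d * u + 1" i] IH by simp
  also have "\<dots> = 2 ^ d * (((u + 1) \<rhd> Suc i) \<rhd> u)"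
    using laver_less [of "u + 1" "Suc i"] by (intro assms) simp
  also have "((u + 1) \<rhd> Suc i) \<rhd> u = (u + 1) \<rhd> i"
    using laver_rec [of "u + 1" i] by simp
  finally show "(2 ^ d * u + 1) \<rhd> i = 2 ^ d * ((u + 1) \<rhd> i)" .
qed

lemma scales_row':
  assumes "scales d b" "u < 2 ^ b"
  shows "(2 ^ d * u + 1) \<rhd> i = 2 ^ d * ((u + 1) \<rhd> i)"
  using assms by (intro scales_row) (auto simp: scales_def)

lemma laver_le_pow: "0 < v \<Longrightarrow> v \<le> 2 ^ b \<Longrightarrow> v \<rhd> 2 ^ b = 0"
  using laver_mod_right [of v b "2 ^ b"] by (cases "v = 2 ^ b") auto

lemma block_map_eq: "y < 2 ^ d \<Longrightarrow> block_map d x (2 ^ d * w + y) = (x + 1) \<rhd> w + y"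
  by (simp add: block_map_def)

lemma block_add_less: "2 ^ d dvd x \<Longrightarrow> 2 ^ d dvd z \<Longrightarrow> x < z \<Longrightarrow> y < 2 ^ d \<Longrightarrow> x + y < (z::nat)"
proof -
  assume "2 ^ d dvd x" "2 ^ d dvd z" "x < z" "y < 2 ^ d"
  then obtain a b where ab: "x = 2 ^ d * a" "z = 2 ^ d * b" by (auto elim!: dvdE)
  then have "Suc a \<le> b" using \<open>x < z\<close> by simp
  then have "2 ^ d * Suc a \<le> 2 ^ d * b" by (rule mult_le_mono2)
  then show "x + y < z" using ab \<open>y < 2 ^ d\<close> by simp
qed

lemma mod_cases_double:
  fixes v :: nat
  assumes "v < 2 ^ Suc e"
  shows "v = v mod 2 ^ e \<or> v = 2 ^ e + v mod 2 ^ e"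
proof -
  have "v div 2 ^ e < 2" using assms by (simp add: less_mult_imp_div_less)
  then have "v div 2 ^ e = 0 \<or> v div 2 ^ e = 1" by linarith
  moreover have "v = 2 ^ e * (v div 2 ^ e) + v mod 2 ^ e" by simp
  ultimately show ?thesis by (metis add_0 mult_0_right mult.right_neutral)
qed

section \<open>The block formula, by induction on \<open>x\<close>\<close>

context
  fixes d b :: nat
  assumes scales: "scales d b" and collapses: "collapses d b" and d: "d > 0" and b: "b > 0"
begin

text \<open>For \<open>y < 2 ^ d\<close>, the element at offset \<open>y\<close> in the last block
  below \<open>2 ^ (d + b)\<close>; \<open>block_map d x\<close> sends it to \<open>x + y\<close>
  when \<open>x\<close> is good.\<close>

private abbreviation (input) "A y \<equiv> 2 ^ d * (2 ^ b - 1) + (y :: nat)"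

private definition good :: "nat \<Rightarrow> bool" where
  "good x \<longleftrightarrow> 2 ^ d dvd x \<and> (x + 1) \<rhd> 2 ^ b = 0"

text \<open>This is what \<open>laver_comp\<close> yields at \<open>A y\<close> once the block
  formula holds for \<open>x\<close>. Proved offset by offset, it returns that formula at the last
  one, since \<open>A (2 ^ d - 1) + 1 = 2 ^ (d + b)\<close>.\<close>

private definition rows :: "nat \<Rightarrow> nat \<Rightarrow> bool" where
  "rows x y \<longleftrightarrow> (\<forall>i. (x + y + 1) \<rhd> i = block_map d x ((A y + 1) \<rhd> i))"

private lemma A_bounds: "2 ^ d * (2 ^ b - 1) + 2 ^ d = (2 ^ (d + b) :: nat)"
    "y < 2 ^ d \<Longrightarrow> A y < 2 ^ (d + b)"
proof -
  have "2 ^ d * (2 ^ b - 1) + 2 ^ d = 2 ^ d * ((2 ^ b - 1) + 1 :: nat)" by (simp only: distrib_left mult_1_right)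
  then show *: "2 ^ d * (2 ^ b - 1) + 2 ^ d = (2 ^ (d + b) :: nat)" by (simp add: power_add)
  show "A y < 2 ^ (d + b)" if "y < 2 ^ d" using that unfolding *[symmetric] by simp
qed

private lemma block_map_A: "good x \<Longrightarrow> y < 2 ^ d \<Longrightarrow> block_map d x (A y) = x + y"
  using laver_below_zero [of "x + 1" "2 ^ b"] by (simp add: block_map_eq good_def)

private lemma rows_from_block:
  assumes "good x" "\<And>i. (x + 2 ^ d) \<rhd> i = block_map d x i" "y < 2 ^ d"
  shows "rows x y"
proof -
  have "(x + 2 ^ d) \<rhd> A y = x + y" using assms block_map_A by simp
  then show ?thesis
    unfolding rows_def using laver_comp [of "x + 2 ^ d" "A y"] assms(2) by simp
qed

text \<open>The collapse at \<open>A t = A (t - 1) + 1\<close>, which lies strictly inside a block,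
  is carried over to \<open>x + t\<close>.\<close>

private lemma rows_collapse:
  assumes "rows x (t - 1)" "0 < t" "t < 2 ^ d"
  shows "(x + t) \<rhd> 2 ^ d = 0"
proof -
  have "A (t - 1) + 1 = A t" using assms by simp
  moreover have "\<not> 2 ^ d dvd A t" using assms not_dvd_block [of "2 ^ d" "2 ^ b - 1" "A t"] by simp
  ultimately have "(A (t - 1) + 1) \<rhd> 2 ^ d = 0"
    using collapses A_bounds(2) [OF assms(3)] unfolding collapses_def by simp
  then have "(x + (t - 1) + 1) \<rhd> 2 ^ d = block_map d x 0" using assms(1) unfolding rows_def by metis
  then show ?thesis using assms(2) by (simp add: block_map_def)
qed

private lemma block_base:
  assumes "u < 2 ^ b"
  shows "(2 ^ d * u + 2 ^ d) \<rhd> i = block_map d (2 ^ d * u) i"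
proof -
  have F: "block_map d (2 ^ d * u) i = 2 ^ d * ((u + 1) \<rhd> (i div 2 ^ d)) + i mod 2 ^ d"
    using scales_row' [OF scales assms] by (simp add: block_map_def)
  show ?thesis
  proof (cases "u + 1 < 2 ^ b")
    case True
    then have "(2 ^ d * (u + 1)) \<rhd> (2 ^ d * (i div 2 ^ d) + i mod 2 ^ d) =
        2 ^ d * ((u + 1) \<rhd> (i div 2 ^ d)) + i mod 2 ^ d"
      by (rule scales_block [OF scales]) simp
    then show ?thesis using F by (simp add: algebra_simps)
  next
    case False
    then have u: "u + 1 = 2 ^ b" using assms by simp
    then have "2 ^ d * u + 2 ^ d = (2 ^ (d + b) :: nat)"
      by (metis distrib_left mult.right_neutral power_add)
    then have "(2 ^ d * u + 2 ^ d) \<rhd> i = i mod 2 ^ (d + b)" by simp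
    also have "\<dots> = 2 ^ d * (i div 2 ^ d mod 2 ^ b) + i mod 2 ^ d"
      by (simp add: power_add mod_mult2_eq)
    finally show ?thesis using F u by simp
  qed
qed

private lemma good_base: "u < 2 ^ b \<Longrightarrow> good (2 ^ d * u)"
  using scales_row' [OF scales, of u "2 ^ b"] laver_le_pow [of "u + 1" b] by (simp add: good_def)

text \<open>Divisibility: \<open>x + 1\<close> is \<open>1\<close> modulo \<open>2 ^ d\<close>, and
  the row of \<open>1\<close> is zero. The period condition comes from \<open>laver_comp\<close> and
  \<open>w + 1 \<le> 2 ^ b\<close>.\<close>

private lemma good_row:
  assumes "good x" "w < 2 ^ b"
  shows "good ((x + 1) \<rhd> w)"
proof -
  obtain q where "x = 2 ^ d * q" using assms(1) by (auto simp: good_def)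
  then have "(x + 1) mod 2 ^ d = 1 mod 2 ^ d" by (simp only: mod_mult_self4)
  moreover have "(1::nat) < 2 ^ d" using d by (intro one_less_power) simp_all
  ultimately have "(x + 1) mod 2 ^ d = 1" by (simp only: mod_less)
  then have "((x + 1) \<rhd> w) mod 2 ^ d = 0" using laver_mod [of "x + 1" w d] laver_less [of 1] by simp
  moreover have "((x + 1) \<rhd> w + 1) \<rhd> 2 ^ b = 0"
    using laver_comp [of "x + 1" w "2 ^ b"] laver_le_pow [of "w + 1" b] assms(2) by simp
  ultimately show ?thesis by (simp add: good_def dvd_eq_mod_eq_0)
qed

text \<open>The elements strictly inside a block only see the last \<open>d\<close> bits of their argument.\<close>

private lemma step_inside:
  assumes "good x" "w < 2 ^ b" "0 < t" "t < 2 ^ d" "rows ((x + 1) \<rhd> w) (t - 1)"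
  shows "((x + 1) \<rhd> w + t) \<rhd> (x + y) = block_map d x ((2 ^ d * w + t) \<rhd> A y)"
proof -
  let ?X = "(x + 1) \<rhd> w" and ?v = "(A (t - 1) + 1) \<rhd> y"
  have u: "rows (2 ^ d * w) (t - 1)"
    using rows_from_block good_base block_base assms by simp
  have "2 ^ d dvd x" using assms(1) by (simp add: good_def)
  then have "(?X + t) \<rhd> (x + y) = (?X + t) \<rhd> y"
    using rows_collapse [OF assms(5,3,4)] laver_add_period_mult by blast
  also have "\<dots> = block_map d ?X ?v"
    using assms(3,5) unfolding rows_def by (metis One_nat_def Suc_pred add.assoc Suc_eq_plus1)
  \<comment> \<open>Translation by \<open>?X + 1\<close> factors through that by
    \<open>w + 1\<close>, and \<open>2 ^ d * w + 1\<close> has the row of \<open>w + 1\<close>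
    scaled by \<open>2 ^ d\<close>.\<close>
  also have "\<dots> = block_map d x (block_map d (2 ^ d * w) ?v)"
    using scales_row' [OF scales assms(2)] laver_comp [of "x + 1" w] by (simp add: block_map_def)
  also have "block_map d (2 ^ d * w) ?v = (2 ^ d * w + t) \<rhd> y"
    using assms(3) u unfolding rows_def by (metis One_nat_def Suc_pred add.assoc Suc_eq_plus1)
  also have "\<dots> = (2 ^ d * w + t) \<rhd> A y"
    using rows_collapse [OF u assms(3,4)] laver_add_period_mult dvd_triv_left by metis
  finally show ?thesis .
qed

text \<open>
  At the lower boundary of a block, \<open>(x + 1) \<rhd> w\<close> and \<open>(x + 1) \<rhd> (w - 1)\<close> are known modulo the top
  bit \<open>2 ^ e\<close> of \<open>x\<close>. If the top bit of the result were wrong, the result would lie in the block of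
  \<open>2 ^ e + x'\<close>, where one can descend to the boundary and get a wrong value there as well.
\<close>

private lemma step_boundary:
  assumes IH: "\<And>z i. z < x \<Longrightarrow> good z \<Longrightarrow> (z + 2 ^ d) \<rhd> i = block_map d z i"
    and IHy: "\<And>t. t < y \<Longrightarrow> rows x t"
    and x: "good x" "2 ^ (d + b) \<le> x" and w: "0 < w" "w < 2 ^ b" and y: "y < 2 ^ d"
  shows "((x + 1) \<rhd> w) \<rhd> (x + y) = (x + 1) \<rhd> (w - 1) + y"
proof (cases "(x + 1) \<rhd> w = 0")
  case True
  then show ?thesis using laver_rec [of "x + 1" "w - 1"] w by simp
next
  case False
  let ?Y = "(x + 1) \<rhd> w" and ?Z = "(x + 1) \<rhd> (w - 1)"
  have dx: "2 ^ d dvd x" and px: "(x + 1) \<rhd> 2 ^ b = 0" using x(1) by (auto simp: good_def)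
  have "1 \<le> x" using x(2) by (meson le_trans one_le_numeral one_le_power)
  then obtain e where e: "2 ^ e \<le> x" "x < 2 ^ Suc e"
    using ex_power_ivl1 [of 2 x] by auto
  have "2 ^ (d + b) < (2::nat) ^ Suc e" using x(2) e(2) by simp
  then have de: "d + b \<le> e" by (simp del: power_Suc)
  have dvde: "2 ^ d dvd (2::nat) ^ e" using de by (simp add: le_imp_power_dvd)
  define x' where "x' = x - 2 ^ e"
  have xx': "x = 2 ^ e + x'" using e by (simp add: x'_def)
  have x'e: "x' < 2 ^ e" using e xx' by simp
  have dx': "2 ^ d dvd x'" unfolding x'_def using dx dvde by (rule dvd_diff_nat)
  have x'x: "x' < x" using xx' by simp
  have small: "x' + s < 2 ^ e" if "s < 2 ^ d" for s
    using block_add_less [OF dx' dvde x'e that] .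
  have one: "(1::nat) < 2 ^ d" using d by (intro one_less_power) simp_all
  have xm: "(x + 1) mod 2 ^ e = x' + 1"
    unfolding xx' add.assoc mod_add_self1 using small [OF one] by simp
  have X': "((x + 1) \<rhd> i) mod 2 ^ e = (x' + 1) \<rhd> i" for i
    using laver_mod [of "x + 1" i e] laver_mod_right [of "x' + 1" e i] small [OF one] xm by simp
  have gx': "good x'" using dx' X' [of "2 ^ b"] px by (simp add: good_def)
  let ?Y' = "(x' + 1) \<rhd> w" and ?Z' = "(x' + 1) \<rhd> (w - 1)"
  have Z'x': "?Z' \<le> x'" using laver_less [of "x' + 1" "w - 1"] by simp
  have Y: "0 < ?Y" "?Y \<le> x" "2 ^ d dvd ?Y"
    using False laver_less [of "x + 1" w] good_row [OF x(1) w(2)] by (auto simp: good_def)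
  have Z: "?Z = ?Y \<rhd> x" using laver_rec [of "x + 1" "w - 1"] w by simp
  have gZ: "good ?Z" "good ?Z'" using good_row x(1) gx' w by auto
  let ?v = "?Y \<rhd> (x + y)"
  \<comment> \<open>By the induction hypothesis for \<open>x'\<close>, translation by
    \<open>x' + 2 ^ d\<close> is a homomorphism taking \<open>2 ^ d * w\<close> to
    \<open>?Y'\<close> and \<open>A y\<close> to \<open>x' + y\<close>.\<close>
  have "?Y' \<rhd> (x' + y) = ((x' + 2 ^ d) \<rhd> (2 ^ d * w)) \<rhd> ((x' + 2 ^ d) \<rhd> A y)"
    using IH [OF x'x gx'] block_map_A [OF gx' y] block_map_eq [of 0 d x' w] by simp
  also have "\<dots> = (x' + 2 ^ d) \<rhd> ((2 ^ d * w) \<rhd> A y)" by (rule laver_distrib [symmetric])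
  also have "(2 ^ d * w) \<rhd> A y = 2 ^ d * (w - 1) + y"
    using scales_block [OF scales w(2) y] laver_top [OF w] by simp
  also have "(x' + 2 ^ d) \<rhd> (2 ^ d * (w - 1) + y) = ?Z' + y"
    using IH [OF x'x gx'] block_map_eq [OF y] by simp
  finally have hom: "?Y' \<rhd> (x' + y) = ?Z' + y" .
  have "(x + y) mod 2 ^ e = x' + y" using small [OF y] xx' by (simp add: add.assoc)
  then have vmod: "?v mod 2 ^ e = ?Z' + y" using laver_mod [of ?Y "x + y" e] X' hom by simp
  have "?v < 2 ^ Suc e" using laver_less [OF Y(1), of "x + y"] Y(2) e(2) by simp
  then have v: "?v = ?Z' + y \<or> ?v = 2 ^ e + ?Z' + y"
    using mod_cases_double [of ?v e] vmod by (simp add: add.assoc)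
  have "?Z \<le> x" using laver_less [of "x + 1" "w - 1"] by simp
  then have "?Z < 2 ^ Suc e" using e(2) by simp
  then have ZZ: "?Z = ?Z' \<or> ?Z = 2 ^ e + ?Z'" using mod_cases_double X' by metis
  \<comment> \<open>Growth inside a block excludes a result without the top bit when
    \<open>?Z\<close> has it.\<close>
  have mono: "?Z + y \<le> ?v"
  proof -
    obtain q where "x = 2 ^ d * q" using dx by blast
    then show ?thesis using laver_block_ge [OF Y(3,1) y, of 0 q] Z by simp
  qed
  have Z'e: "?Z' + y < 2 ^ e" using Z'x' small [OF y] by simp
  show ?thesis
  proof (cases "?Z = 2 ^ e + ?Z'")
    case True
    then show ?thesis using v mono Z'e by linarith
  next
    case False
    then have ZZ': "?Z = ?Z'" using ZZ by simp
    show ?thesis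
    proof (rule ccontr)
      assume "?v \<noteq> ?Z + y"
      then have v': "?v = 2 ^ e + ?Z' + y" using v ZZ' by simp
      define z where "z = 2 ^ e + ?Z'"
      have zx: "z \<le> x" using Z'x' xx' by (simp add: z_def)
      have rz: "rows z t" if "t < y" for t
      proof (cases "z = x")
        case True
        then show ?thesis using IHy that by simp
      next
        case False
        then have lt: "z < x" using zx by simp
        have Z1: "?Z' + 1 < 2 ^ e" using Z'x' small [OF one] by simp
        \<comment> \<open>The period of \<open>w < 2 ^ b\<close> divides \<open>2 ^ (b - 1)\<close>,
          hence so does that of \<open>?Z' + 1\<close>. Restoring the top bit at most doubles this
          bound, which makes \<open>z\<close> good.\<close>
        have "(?Z' + 1) \<rhd> 2 ^ (b - 1) = (x' + 1) \<rhd> (w \<rhd> 2 ^ (b - 1))"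
          using laver_comp [of "x' + 1" "w - 1" "2 ^ (b - 1)"] w by simp
        also have "w \<rhd> 2 ^ (b - 1) = 0"
          using laver_half_period [of w "b - 1"] w b by simp
        finally have "(?Z' + 1) \<rhd> 2 ^ (b - 1) = 0" by simp
        moreover have "(z + 1) mod 2 ^ e = ?Z' + 1"
          unfolding z_def add.assoc mod_add_self1 using Z1 by simp
        ultimately have "((z + 1) \<rhd> 2 ^ (b - 1)) mod 2 ^ e = 0"
          using laver_mod [of "z + 1" "2 ^ (b - 1)" e] Z1
            laver_mod_right [of "?Z' + 1" e "2 ^ (b - 1)"] by simp
        then have "(z + 1) \<rhd> 2 ^ (b - 1 + 1) = 0"
          using Z1 by (intro laver_period_growth [of _ e]) (auto simp: z_def dvd_eq_mod_eq_0)
        then have "good z"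
          using b gZ(2) dvde by (simp add: good_def z_def dvd_add)
        then show ?thesis using IH [OF lt] rows_from_block that y by simp
      qed
      \<comment> \<open>Descent from \<open>x + y\<close> to \<open>x\<close>: the period of
        \<open>z + (y - s)\<close> divides \<open>2 ^ d\<close>, and \<open>?Y - 1\<close> is
        \<open>2 ^ d - 1\<close> modulo \<open>2 ^ d\<close>, so every step lowers the value by one.
        At \<open>x\<close> this gives \<open>?Z = z\<close>, although \<open>?Z\<close> lacks the
        top bit.\<close>
      have "?Y \<rhd> (x + (y - s)) = z + (y - s)" if "s \<le> y" for s
        using that
      proof (induction s)
        case 0
        then show ?case using v' by (simp add: z_def)
      next
        case (Suc s)
        let ?t = "y - s"
        have t: "0 < ?t" "?t < 2 ^ d" "?t - 1 < y" using Suc.prems y by auto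
        have p: "(z + ?t) \<rhd> 2 ^ d = 0" by (rule rows_collapse [OF rz [OF t(3)] t(1,2)])
        obtain q where q: "?Y = 2 ^ d * q" using Y(3) by blast
        then obtain q' where "q = Suc q'" using Y(1) gr0_implies_Suc [of q] by auto
        then have "?Y - 1 = 2 ^ d * q' + (2 ^ d - 1)" using q by simp
        then have "(z + ?t) \<rhd> (?Y - 1) = (z + ?t) \<rhd> (2 ^ d - 1)"
          by (simp only: laver_add_period_mult [OF p dvd_triv_left])
        also have "\<dots> = z + ?t - 1" using laver_below_zero [OF _ p] t by simp
        finally have "(?Y \<rhd> (x + ?t)) \<rhd> (?Y - 1) = z + ?t - 1" using Suc by simp
        moreover have "Suc (x + (y - Suc s)) = x + ?t" "z + ?t - 1 = z + (y - Suc s)"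
          using Suc.prems by simp_all
        ultimately show ?case using laver_rec [OF Y(1), of "x + (y - Suc s)"] by metis
      qed
      from this [of y] have "?Z = z" using Z by simp
      then show False using False by (simp add: z_def)
    qed
  qed
qed

text \<open>Nested inductions on \<open>x\<close> and on the offset \<open>y\<close>, then descent
  in the argument. One recursion step meets offset \<open>t\<close> of block \<open>w\<close>,
  handled by \<open>step_inside\<close> for \<open>t > 0\<close> and by \<open>step_boundary\<close>
  for \<open>t = 0 < w\<close>.\<close>

lemma blocksI_pos: "blocks d b"
proof -
  have main: "\<forall>i. (x + 2 ^ d) \<rhd> i = block_map d x i" if "good x" for x
    using that
  proof (induction x rule: less_induct)
    case (less x)
    have dx: "2 ^ d dvd x" and px: "(x + 1) \<rhd> 2 ^ b = 0" using less.prems by (auto simp: good_def)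
    show ?case
    proof (cases "x < 2 ^ (d + b)")
      case True
      obtain u where "x = 2 ^ d * u" using dx by blast
      moreover from this have "u < 2 ^ b" using True by (simp add: power_add)
      ultimately show ?thesis using block_base by simp
    next
      case False
      have IH: "(z + 2 ^ d) \<rhd> i = block_map d z i" if "z < x" "good z" for z i
        using less.IH [OF that] by simp
      have rows: "rows x y" if "y < 2 ^ d" for y
        using that
      proof (induction y rule: less_induct)
        case (less y)
        have IHy: "rows x t" if "t < y" for t
          using less.IH [OF that] less.prems that by simp
        have "(x + y + 1) \<rhd> i = block_map d x ((A y + 1) \<rhd> i)" for i
        proof (rule laver_descend [where y = i and B = "x + y + 1 + (A y + 1)"])
          fix N assume "x + y + 1 + (A y + 1) < 2 ^ N"
          then have "(x + y + 1) \<rhd> (2 ^ N - 1) = x + y" "(A y + 1) \<rhd> (2 ^ N - 1) = A y"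
            using laver_top [of "x + y + 1" N] laver_top [of "A y + 1" N] by simp_all
          then show "(x + y + 1) \<rhd> (2 ^ N - 1) = block_map d x ((A y + 1) \<rhd> (2 ^ N - 1))"
            using block_map_A [OF \<open>good x\<close> less.prems] by simp
        next
          fix i
          define r where "r = (A y + 1) \<rhd> Suc i"
          define w t where "w = r div 2 ^ d" and "t = r mod 2 ^ d"
          assume "(x + y + 1) \<rhd> Suc i = block_map d x ((A y + 1) \<rhd> Suc i)"
          then have eq: "(x + y + 1) \<rhd> i = block_map d x r \<rhd> (x + y)" "(A y + 1) \<rhd> i = r \<rhd> A y"
            using laver_rec [of "x + y + 1" i] laver_rec [of "A y + 1" i] by (simp_all add: r_def)
          have r: "r = 2 ^ d * w + t" "t < 2 ^ d" by (simp_all add: w_def t_def)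
          have Fr: "block_map d x r = (x + 1) \<rhd> w + t" by (simp add: block_map_def w_def t_def)
          have "r \<le> A y" using laver_less [of "A y + 1" "Suc i"] by (simp add: r_def)
          then have "r < 2 ^ b * 2 ^ d"
            using A_bounds(2) [OF less.prems] by (simp add: power_add mult.commute)
          then have w: "w < 2 ^ b" unfolding w_def by (rule less_mult_imp_div_less)
          \<comment> \<open>If \<open>(x + 1) \<rhd> w\<close> is \<open>x\<close> itself, only
            offsets below \<open>y\<close> are available, and \<open>t - 1\<close> must be one of
            them.\<close>
          have ty: "t \<le> y"
          proof (cases "y + 1 < 2 ^ d")
            case True
            then have "(A y + 1) mod 2 ^ d = y + 1" by (simp add: mod_mult_self4 add.assoc)
            then have "t = (y + 1) \<rhd> (Suc i mod 2 ^ d)"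
              using laver_mod [of "A y + 1" "Suc i" d] by (simp add: t_def r_def)
            then show ?thesis using laver_less [of "y + 1" "Suc i mod 2 ^ d"] by simp
          qed (use r(2) in simp)
          have "((x + 1) \<rhd> w + t) \<rhd> (x + y) = block_map d x (r \<rhd> A y)"
          proof (cases "t = 0")
            case t: False
            have g: "good ((x + 1) \<rhd> w)" by (rule good_row [OF \<open>good x\<close> w])
            have "rows ((x + 1) \<rhd> w) (t - 1)"
            proof (cases "(x + 1) \<rhd> w = x")
              case True
              then show ?thesis using IHy [of "t - 1"] t ty by simp
            next
              case False
              then have "(x + 1) \<rhd> w < x" using laver_less [of "x + 1" w] by simp
              then show ?thesis using IH g r(2) by (intro rows_from_block) auto
            qed
            then show ?thesis using step_inside [OF \<open>good x\<close> w _ r(2)] t r(1) by simp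
          next
            case t: True
            show ?thesis
            proof (cases "w = 0")
              case True
              then show ?thesis using t r(1) block_map_A [OF \<open>good x\<close> less.prems] by simp
            next
              case wpos: False
              then have "r \<rhd> A y = 2 ^ d * (w - 1) + y"
                using scales_block [OF scales w less.prems, of "2 ^ b - 1"] laver_top [of w b] t r(1) w
                by simp
              then have "block_map d x (r \<rhd> A y) = (x + 1) \<rhd> (w - 1) + y"
                using block_map_eq [OF less.prems] by simp
              then show ?thesis
                using step_boundary [OF IH IHy \<open>good x\<close> _ _ w less.prems] wpos t False by simp
            qed
          qed
          then show "(x + y + 1) \<rhd> i = block_map d x ((A y + 1) \<rhd> i)"
            using eq Fr by simp
        qed
        then show ?case unfolding rows_def by blast
      qed
      show ?thesis
      proof
        fix i
        have "A (2 ^ d - 1) + 1 = 2 ^ (d + b)" using A_bounds(1) by simp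
        moreover have "(x + (2 ^ d - 1) + 1) \<rhd> i = block_map d x ((A (2 ^ d - 1) + 1) \<rhd> i)"
          using rows [of "2 ^ d - 1"] unfolding rows_def by simp
        ultimately have "(x + 2 ^ d) \<rhd> i = block_map d x (i mod 2 ^ (d + b))" by simp
        also have "i mod 2 ^ (d + b) = 2 ^ d * (i div 2 ^ d mod 2 ^ b) + i mod 2 ^ d"
          by (simp add: power_add mod_mult2_eq)
        also have "block_map d x \<dots> = block_map d x i"
          using laver_mod_period [OF px, of "i div 2 ^ d"] by (simp add: block_map_def)
        finally show "(x + 2 ^ d) \<rhd> i = block_map d x i" .
      qed
    qed
  qed
  then show ?thesis unfolding blocks_def good_def by blast
qed

end

lemma blocks_0: "blocks 0 b"
  by (simp add: blocks_def block_map_def)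

section \<open>Doubling the block size\<close>

lemma blocksI: "scales d b \<Longrightarrow> collapses d b \<Longrightarrow> b > 0 \<Longrightarrow> blocks d b"
  using blocksI_pos blocks_0 by (cases "d = 0") auto

text \<open>If \<open>2 ^ b\<close> divides \<open>u\<close>, then \<open>2 ^ d * u\<close> is a
  multiple of \<open>2 ^ (d + b)\<close> and \<open>scales_block\<close> computes both sides.
  Otherwise the period of \<open>u = Suc u'\<close> divides \<open>2 ^ b\<close> by the collapse, so
  the block formula at \<open>2 ^ d * u'\<close> gives the row of \<open>2 ^ d * u\<close>.\<close>

lemma scales_double:
  assumes blocks: "blocks d b" and sc: "scales (d + b) b" "scales b b" and coll: "collapses b b"
  shows "scales d (2 * b)"
proof -
  have "(2 ^ d * u) \<rhd> (2 ^ d * v) = 2 ^ d * (u \<rhd> v)" if "u < 2 ^ (2 * b)" for u v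
    using that
  proof (induction u arbitrary: v rule: less_induct)
    case (less u)
    have u: "u < 2 ^ (b + b)" using less.prems by (simp add: mult_2)
    show ?case
    proof (cases "2 ^ b dvd u")
      case True
      then obtain q where q: "u = 2 ^ b * q" ..
      then have q': "q < 2 ^ b" using u by (simp add: power_add)
      have m: "v mod 2 ^ b < 2 ^ b" by simp
      have v: "v = 2 ^ b * (v div 2 ^ b) + v mod 2 ^ b" by simp
      have "2 ^ d * (v mod 2 ^ b) < 2 ^ (d + b)" using m by (simp add: power_add)
      then have "(2 ^ (d + b) * q) \<rhd> (2 ^ (d + b) * (v div 2 ^ b) + 2 ^ d * (v mod 2 ^ b)) =
          2 ^ (d + b) * (q \<rhd> (v div 2 ^ b)) + 2 ^ d * (v mod 2 ^ b)"
        by (rule scales_block [OF sc(1) q'])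
      moreover have "u \<rhd> v = 2 ^ b * (q \<rhd> (v div 2 ^ b)) + v mod 2 ^ b"
        using scales_block [OF sc(2) q' m, of "v div 2 ^ b"] q by simp
      moreover have "2 ^ (d + b) * (v div 2 ^ b) + 2 ^ d * (v mod 2 ^ b) = 2 ^ d * v"
        by (subst (3) v) (simp only: distrib_left power_add mult.assoc)
      ultimately show ?thesis using q by (simp add: power_add algebra_simps)
    next
      case False
      then obtain u' where u': "u = Suc u'" by (cases u) auto
      have row: "(2 ^ d * u' + 1) \<rhd> i = 2 ^ d * (u \<rhd> i)" for i
        using scales_row [of u' d i] less.IH less.prems u' by simp
      have "u \<rhd> 2 ^ b = 0" using coll u False by (simp add: collapses_def)
      then have "(2 ^ d * u' + 2 ^ d) \<rhd> (2 ^ d * v) = block_map d (2 ^ d * u') (2 ^ d * v)"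
        using blocks row by (simp add: blocks_def)
      then show ?thesis using row u' by (simp add: block_map_def algebra_simps)
    qed
  qed
  then show ?thesis by (simp add: scales_def)
qed

text \<open>
  The element \<open>2 ^ (d + q) - 2 ^ (d - q) + 2 ^ (d - 2 * q)\<close> sends \<open>2 ^ (d - q)\<close> to \<open>2 ^ d\<close>; translating
  by it reduces the collapse of \<open>z\<close> at \<open>2 ^ d\<close> to that of a smaller element.
\<close>

definition shifter :: "nat \<Rightarrow> nat \<Rightarrow> nat" where
  "shifter d q = 2 ^ (d - 2 * q) * (2 ^ (3 * q) - 2 ^ q + 1)"

lemma shifter_laver:
  assumes "scales (d - q) (2 * q)" "blocks (d - 2 * q) (2 * q)" "2 * q \<le> d" "q > 0"
  shows "shifter d q \<rhd> 2 ^ (d - q) = 2 ^ d"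
proof -
  \<comment> \<open>The shifter is \<open>x + 2 ^ (d - 2 * q)\<close>, and the row of
    \<open>x + 1\<close> is reduction modulo \<open>2 ^ (2 * q)\<close> scaled by
    \<open>2 ^ (d - q)\<close>. The argument \<open>2 ^ (d - q)\<close> is the start of block
    \<open>2 ^ q\<close>.\<close>
  define x :: nat where "x = 2 ^ (d - q) * (2 ^ (2 * q) - 1)"
  have "d - q = (d - 2 * q) + q" using assms(3) by simp
  then have pow: "(2::nat) ^ (d - q) = 2 ^ (d - 2 * q) * 2 ^ q" by (simp only: power_add)
  have row: "(x + 1) \<rhd> i = 2 ^ (d - q) * (i mod 2 ^ (2 * q))" for i
    using scales_row' [OF assms(1), of "2 ^ (2 * q) - 1" i] by (simp add: x_def)
  have "2 ^ (d - 2 * q) dvd x" unfolding x_def pow by simp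
  moreover have "(x + 1) \<rhd> 2 ^ (2 * q) = 0" using row by simp
  ultimately have "(x + 2 ^ (d - 2 * q)) \<rhd> 2 ^ (d - q) = block_map (d - 2 * q) x (2 ^ (d - q))"
    using assms(2) by (simp add: blocks_def)
  also have "\<dots> = (x + 1) \<rhd> 2 ^ q" by (simp add: block_map_def pow)
  also have "\<dots> = 2 ^ (d - q) * 2 ^ q" using row assms(4) by simp
  also have "\<dots> = 2 ^ d" using assms(3) by (simp flip: power_add)
  also have "x + 2 ^ (d - 2 * q) = shifter d q"
  proof -
    have "(2::nat) ^ (3 * q) = 2 ^ q * 2 ^ (2 * q)" by (simp flip: power_add)
    then show ?thesis unfolding x_def shifter_def pow by (simp add: algebra_simps)
  qed
  finally show ?thesis .
qed

text \<open>Induction on \<open>z\<close>. Unless \<open>z \<rhd> 2 ^ d\<close> vanishes, the period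
  of \<open>z mod 2 ^ d\<close> divides \<open>2 ^ (d - 2 ^ j)\<close> for each
  \<open>j \<le> k\<close> in turn; at \<open>j = k\<close>, \<open>laver_period_growth\<close>
  concludes.\<close>

lemma collapsesI:
  assumes dvd: "2 ^ k dvd d" and d: "d > 0"
    and shift: "\<And>j. j < k \<Longrightarrow> shifter d (2 ^ j) \<rhd> 2 ^ (d - 2 ^ j) = 2 ^ d"
  shows "collapses d (2 ^ k)"
proof -
  have "z \<rhd> 2 ^ d = 0" if "z < 2 ^ (d + 2 ^ k)" "\<not> 2 ^ d dvd z" for z
    using that
  proof (induction z rule: less_induct)
    case (less z)
    define s where "s = z mod 2 ^ d"
    have s: "0 < s" "s < 2 ^ d" using less.prems(2) by (auto simp: s_def dvd_eq_mod_eq_0)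
    have z: "z > 0" using less.prems(2) by (intro gr0I) auto
    have zs: "(z \<rhd> i) mod 2 ^ d = s \<rhd> i" for i
      using laver_mod [of z i d] laver_mod_right [OF s, of i] by (simp add: s_def)
    have kd: "2 ^ k \<le> d" using dvd d by (rule dvd_imp_le)
    have "z \<rhd> 2 ^ d = 0 \<or> s \<rhd> 2 ^ (d - 2 ^ j) = 0" if "j \<le> k" for j
      using that
    proof (induction j)
      case 0
      then show ?case using laver_half_period [of s "d - 1"] s d by simp
    next
      case (Suc j)
      let ?c = "shifter d (2 ^ j)"
      define b where "b = z \<rhd> ?c"
      have b: "b < z" using laver_less [OF z] by (simp add: b_def)
      have "z \<rhd> 2 ^ d = 0 \<or> s \<rhd> 2 ^ (d - 2 ^ j) = 0" using Suc by simp
      then consider "z \<rhd> 2 ^ d = 0" | "s \<rhd> 2 ^ (d - 2 ^ j) = 0" "\<not> 2 ^ d dvd b" | "2 ^ d dvd b"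
        by argo
      then show ?case
      proof cases
        \<comment> \<open>The collapse of the smaller \<open>b\<close> gives
          \<open>b \<rhd> (z \<rhd> 2 ^ (d - 2 ^ j)) = 0\<close>, the right factor being a multiple
          of \<open>2 ^ d\<close>; by distributivity this is \<open>z \<rhd> 2 ^ d\<close>.\<close>
        case 2
        have "b \<rhd> 2 ^ d = 0" using less.IH [OF b] 2 b less.prems(1) by simp
        moreover have "2 ^ d dvd z \<rhd> 2 ^ (d - 2 ^ j)" using zs 2(1) by (simp add: dvd_eq_mod_eq_0)
        ultimately have "b \<rhd> (z \<rhd> 2 ^ (d - 2 ^ j)) = 0" by (rule laver_zero_mult)
        then show ?thesis
          using laver_distrib [of z ?c "2 ^ (d - 2 ^ j)"] shift [of j] Suc.prems by (simp add: b_def)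
      next
        \<comment> \<open>Here the shifter is a zero of the row of \<open>s\<close>; dropping its
          odd factor doubles the exponent gap \<open>2 ^ j\<close>.\<close>
        case 3
        then have "s \<rhd> ?c = 0" using zs by (simp add: b_def dvd_eq_mod_eq_0)
        moreover have "odd (2 ^ (3 * 2 ^ j) - 2 ^ 2 ^ j + 1 :: nat)" by simp
        ultimately have "s \<rhd> 2 ^ (d - 2 * 2 ^ j) = 0"
          using laver_zero_odd s(1) unfolding shifter_def by blast
        then show ?thesis by simp
      qed simp
    qed
    from this [OF order_refl] consider "z \<rhd> 2 ^ d = 0" | "s \<rhd> 2 ^ (d - 2 ^ k) = 0" by argo
    then show ?case
    proof cases
      case 2
      then have "2 ^ d dvd z \<rhd> 2 ^ (d - 2 ^ k)" using zs by (simp add: dvd_eq_mod_eq_0)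
      then have "z \<rhd> 2 ^ (d - 2 ^ k + 2 ^ k) = 0"
        by (rule laver_period_growth [OF z less.prems(1)])
      then show ?thesis using kd by simp
    qed
  qed
  then show ?thesis by (simp add: collapses_def)
qed

section \<open>Induction on the block size\<close>

lemma scales_1: "scales m 1"
proof -
  have "(2 ^ m * u) \<rhd> (2 ^ m * v) = 2 ^ m * (u \<rhd> v)" if "u < 2" for u v
    using that laver_less [of 1 v] by (cases "u = 0") (auto simp: less_2_cases_iff)
  then show ?thesis by (simp add: scales_def)
qed

text \<open>Strong induction on \<open>k\<close> for all \<open>m\<close>, with an inner induction
  on \<open>m\<close>. The doubled width in the scaling part starts the next \<open>k\<close> and is
  also what \<open>shifter_laver\<close> requires.\<close>

lemma scales_blocks:
  "scales (m * 2 ^ k) (2 * 2 ^ k) \<and> blocks (m * 2 ^ k) (2 ^ k)"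
proof (induction k arbitrary: m rule: less_induct)
  case (less k)
  have S: "scales (m * 2 ^ k) (2 ^ k)" for m
  proof (cases k)
    case 0
    then show ?thesis using scales_1 by simp
  next
    case (Suc j)
    then show ?thesis using less.IH [of j "2 * m"] by (simp add: mult.assoc mult.left_commute)
  qed
  have CB: "collapses (m * 2 ^ k) (2 ^ k) \<and> blocks (m * 2 ^ k) (2 ^ k)" for m
  proof (induction m)
    case 0
    show ?case by (simp add: collapses_def blocks_0)
  next
    case (Suc m)
    have "collapses (Suc m * 2 ^ k) (2 ^ k)"
    proof (rule collapsesI)
      fix j assume j: "j < k"
      define i where "i = k - Suc j"
      have k: "2 ^ k = 2 * 2 ^ i * (2::nat) ^ j"
        using j by (simp add: i_def flip: power_add power_Suc)
      have 1: "scales (Suc m * 2 ^ k - 2 ^ j) (2 * 2 ^ j)"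
      proof -
        have "Suc m * 2 ^ k - 2 ^ j = (Suc m * (2 * 2 ^ i) - 1) * 2 ^ j"
          unfolding k by (simp add: diff_mult_distrib algebra_simps)
        then show ?thesis using less.IH [OF j] by metis
      qed
      \<comment> \<open>For \<open>2 * 2 ^ j = 2 ^ k\<close> this is the block formula of the
        preceding \<open>m\<close>; for smaller \<open>j\<close> it comes from the outer induction
        at \<open>Suc j\<close>.\<close>
      have 2: "blocks (Suc m * 2 ^ k - 2 * 2 ^ j) (2 * 2 ^ j)"
      proof (cases "Suc j = k")
        case True
        then have "2 * 2 ^ j = (2::nat) ^ k" by auto
        then show ?thesis using Suc by simp
      next
        case False
        then have "Suc j < k" using j by simp
        moreover have "Suc m * 2 ^ k - 2 * 2 ^ j = (Suc m * 2 ^ i - 1) * 2 ^ Suc j"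
          unfolding k by (simp add: diff_mult_distrib algebra_simps)
        ultimately show ?thesis using less.IH [of "Suc j" "Suc m * 2 ^ i - 1"] by simp
      qed
      have "2 * 2 ^ j \<le> Suc m * 2 ^ k"
      proof -
        have "2 ^ Suc j \<le> (2::nat) ^ k" using j by (intro power_increasing) simp_all
        then show ?thesis by simp
      qed
      then show "shifter (Suc m * 2 ^ k) (2 ^ j) \<rhd> 2 ^ (Suc m * 2 ^ k - 2 ^ j) = 2 ^ (Suc m * 2 ^ k)"
        using shifter_laver [OF 1 2] by simp
    qed simp_all
    moreover from this have "blocks (Suc m * 2 ^ k) (2 ^ k)" by (rule blocksI [OF S]) simp
    ultimately show ?case by (rule conjI)
  qed
  have "scales (m * 2 ^ k) (2 * 2 ^ k)"
    using scales_double [of "m * 2 ^ k" "2 ^ k"] CB [of m] CB [of 1] S [of "Suc m"] S [of 1]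
    by (simp add: add.commute)
  then show ?case using CB by simp
qed

section \<open>Generated subalgebras as rows, and the isomorphism\<close>

lemma laver_gen_eq: "laver_gen x = range (\<lambda>i. (x + 1) \<rhd> i)"
proof
  have top: "(x + 1) \<rhd> (2 ^ N - 1) = x" if "x + 1 < 2 ^ N" for N
    using laver_top [of "x + 1" N] that by simp
  show "laver_gen x \<subseteq> range (\<lambda>i. (x + 1) \<rhd> i)"
  proof
    fix u assume "u \<in> laver_gen x"
    then show "u \<in> range (\<lambda>i. (x + 1) \<rhd> i)"
    proof induction
      case base
      have "x + 1 < 2 ^ (x + 1)" by (rule less_exp)
      then show ?case using top by (metis rangeI)
    next
      case (step u v)
      then obtain i j where "u = (x + 1) \<rhd> i" "v = (x + 1) \<rhd> j" by auto
      then have "u \<rhd> v = (x + 1) \<rhd> (i \<rhd> j)" using laver_distrib by simp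
      then show ?case by blast
    qed
  qed
  \<comment> \<open>The recursion for the row of \<open>x + 1\<close> multiplies by \<open>x\<close>
    on the right, so walking down from the value \<open>x\<close> stays in the subalgebra.\<close>
  have "(x + 1) \<rhd> i \<in> laver_gen x" for i
  proof (rule laver_descend [where y = i and B = "x + 1"])
    fix N assume "x + 1 < 2 ^ N"
    then show "(x + 1) \<rhd> (2 ^ N - 1) \<in> laver_gen x" using top laver_gen.base by simp
  next
    fix i assume "(x + 1) \<rhd> Suc i \<in> laver_gen x"
    then have "((x + 1) \<rhd> Suc i) \<rhd> x \<in> laver_gen x" using laver_gen.base by (rule laver_gen.step)
    then show "(x + 1) \<rhd> i \<in> laver_gen x" using laver_rec [of "x + 1" i] by simp
  qed
  then show "range (\<lambda>i. (x + 1) \<rhd> i) \<subseteq> laver_gen x" by blast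
qed

lemma laver_period_zero:
  assumes "x > 0"
  shows "x \<rhd> laver_period x = 0" "\<And>i. 0 < i \<Longrightarrow> i < laver_period x \<Longrightarrow> x \<rhd> i > 0"
proof -
  have "\<exists>p. p > 0 \<and> x \<rhd> p = 0"
    using laver_zeros [OF assms] by (metis dvd_refl zero_less_numeral zero_less_power)
  then have "laver_period x > 0 \<and> x \<rhd> laver_period x = 0"
    unfolding laver_period_def by (rule LeastI_ex)
  then show "x \<rhd> laver_period x = 0" by simp
  show "x \<rhd> i > 0" if "0 < i" "i < laver_period x" for i
    using that not_less_Least [of i "\<lambda>p. p > 0 \<and> x \<rhd> p = 0"] unfolding laver_period_def by auto
qed

lemma laver_inj_on_period:
  assumes "x > 0"
  shows "inj_on (\<lambda>i. x \<rhd> i) {..<laver_period x}"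
proof (rule linorder_inj_onI')
  fix i j assume "i \<in> {..<laver_period x}" "j \<in> {..<laver_period x}" "i < j"
  then have "x \<rhd> i + (j - i) \<le> x \<rhd> j"
    using laver_period_zero(2) [OF assms] by (intro laver_mono assms) auto
  then show "x \<rhd> i \<noteq> x \<rhd> j" using \<open>i < j\<close> by simp
qed

theorem theorem4p1:
  fixes a x y m n l :: nat
  assumes "a = x + 2 ^ (m * n) * y"
    and "\<exists>k. n = 2 ^ k"
    and "y < 2 ^ n"
    and "2 ^ ((m + 1) * n) dvd x"
    and "laver_period (x + 1) = 2 ^ l"
    and "l \<le> n"
  shows "\<exists>\<phi>. laver_iso \<phi> (laver_gen (2 ^ (l + n) - 2 ^ n + y)) (laver_gen a) \<and>
    (\<forall>i w y'. y' < 2 ^ n \<and> (2 ^ (l + n) - 2 ^ n + y + 1) \<rhd> i = 2 ^ n * w + y' \<longrightarrow>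
       \<phi> ((2 ^ (l + n) - 2 ^ n + y + 1) \<rhd> i) = (a + 1) \<rhd> i \<and>
       (a + 1) \<rhd> i = ((x + 1) \<rhd> w) + 2 ^ (m * n) * y')"
proof -
  obtain k where k: "n = 2 ^ k" using assms(2) by blast
  define d where "d = (m + 1) * n"
  define A where "A = 2 ^ (l + n) - 2 ^ n + y"
  \<comment> \<open>\<open>U\<close> is \<open>A\<close> with \<open>l\<close> replaced by
    \<open>n\<close>. Its successor's row is found first, because translation by
    \<open>x + 2 ^ d\<close> sends \<open>2 ^ (m * n) * U\<close> to \<open>a\<close>; the row of
    \<open>A + 1\<close> then follows by reduction.\<close>
  define U where "U = 2 ^ n * (2 ^ n - 1) + y"
  have n: "n > 0" using k by simp
  have d: "d = m * n + n" "d > 0" using n by (simp_all add: d_def)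
  have blocks: "blocks d n" and scales: "scales (m * n) (2 * n)"
    using scales_blocks [of "m + 1" k] scales_blocks [of m k] by (simp_all add: d_def k)
  have pl: "(x + 1) \<rhd> 2 ^ l = 0" using laver_period_zero(1) [of "x + 1"] assms(5) by simp
  have pn: "(x + 1) \<rhd> 2 ^ n = 0"
    using laver_zero_mult [OF pl] assms(6) by (simp add: le_imp_power_dvd)
  have dx: "2 ^ d dvd x" using assms(4) by (simp add: d_def)
  have bm: "(x + 2 ^ d) \<rhd> i = block_map d x i" for i
    using blocks dx pn by (simp add: blocks_def)
  have shrink: "2 ^ (m * n) * i div 2 ^ d = i div 2 ^ n"
    "2 ^ (m * n) * i mod 2 ^ d = 2 ^ (m * n) * (i mod 2 ^ n)" for i :: nat
    by (simp_all add: d(1) power_add)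
  have top: "(x + 1) \<rhd> (2 ^ n - 1) = x" using laver_below_zero [OF _ pn] by simp
  have U: "U < 2 ^ (2 * n)"
  proof -
    have "U < 2 ^ n * (2 ^ n - 1) + 2 ^ n" using assms(3) by (simp add: U_def)
    also have "\<dots> = 2 ^ n * (2 ^ n - 1 + 1)" by (simp only: distrib_left mult_1_right)
    finally show ?thesis by (simp add: mult_2 power_add)
  qed
  have "(x + 2 ^ d) \<rhd> (2 ^ (m * n) * U) = a"
    unfolding bm block_map_def shrink using assms(1,3) top by (simp add: U_def)
  then have "(a + 1) \<rhd> i = (x + 2 ^ d) \<rhd> ((2 ^ (m * n) * U + 1) \<rhd> i)" for i
    using laver_comp [of "x + 2 ^ d" "2 ^ (m * n) * U" i] by simp
  then have row: "(a + 1) \<rhd> i =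
      (x + 1) \<rhd> (((U + 1) \<rhd> i) div 2 ^ n) + 2 ^ (m * n) * (((U + 1) \<rhd> i) mod 2 ^ n)" for i
    unfolding scales_row' [OF scales U] bm block_map_def shrink .
  define \<phi> where "\<phi> v = (x + 1) \<rhd> (v div 2 ^ n) + 2 ^ (m * n) * (v mod 2 ^ n)" for v
  have A': "A = 2 ^ n * (2 ^ l - 1) + y"
    by (simp add: A_def power_add algebra_simps)
  have Asum: "2 ^ n * (2 ^ l - 1) + 2 ^ n = (2 ^ (l + n) :: nat)"
  proof -
    have "2 ^ n * (2 ^ l - 1) + 2 ^ n = (2 ^ n * (2 ^ l - 1 + 1) :: nat)"
      by (simp only: distrib_left mult_1_right)
    then show ?thesis by (simp add: power_add)
  qed
  have Ale: "A + 1 \<le> 2 ^ (l + n)" using assms(3) unfolding A' Asum [symmetric] by simp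
  \<comment> \<open>\<open>U\<close> and \<open>A\<close> agree modulo \<open>2 ^ (l + n)\<close>,
    and the row of \<open>A + 1\<close> stays below that bound.\<close>
  have reduce: "(A + 1) \<rhd> i = ((U + 1) \<rhd> i) mod 2 ^ (l + n)" for i
  proof -
    have "U + 1 = (A + 1) + 2 ^ (l + n) * (2 ^ (n - l) - 1)"
    proof -
      have "(2::nat) ^ l * (2 ^ (n - l) - 1) = 2 ^ n - 2 ^ l"
        using assms(6) by (simp add: diff_mult_distrib2 flip: power_add)
      then have "2 ^ (l + n) * (2 ^ (n - l) - 1) = 2 ^ n * (2 ^ n - 2 ^ l :: nat)"
        by (metis mult.assoc mult.commute power_add)
      moreover have "2 ^ n * (2 ^ n - 1) = 2 ^ n * (2 ^ l - 1) + 2 ^ n * (2 ^ n - 2 ^ l :: nat)"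
      proof -
        have "2 ^ l \<le> (2::nat) ^ n" "1 \<le> (2::nat) ^ l" using assms(6) by simp_all
        then have "2 ^ n - 1 = (2 ^ l - 1) + (2 ^ n - 2 ^ l :: nat)" by linarith
        then show ?thesis by (simp only: distrib_left)
      qed
      ultimately show ?thesis by (simp add: U_def A')
    qed
    then have "(U + 1) mod 2 ^ (l + n) = (A + 1) mod 2 ^ (l + n)" by (simp only: mod_mult_self2)
    then have "((U + 1) \<rhd> i) mod 2 ^ (l + n) = ((A + 1) \<rhd> i) mod 2 ^ (l + n)"
      by (simp only: laver_mod)
    moreover have "(A + 1) \<rhd> i < 2 ^ (l + n)" using laver_less [of "A + 1" i] Ale by simp
    ultimately show ?thesis by simp
  qed
  \<comment> \<open>Reduction modulo \<open>2 ^ (l + n)\<close> cuts the block index to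
    \<open>l\<close> bits, which the row of \<open>x + 1\<close> does not notice, having period
    \<open>2 ^ l\<close>.\<close>
  have \<phi>_row: "\<phi> ((A + 1) \<rhd> i) = (a + 1) \<rhd> i" for i
  proof -
    have "(A + 1) \<rhd> i = 2 ^ n * (((U + 1) \<rhd> i) div 2 ^ n mod 2 ^ l) + ((U + 1) \<rhd> i) mod 2 ^ n"
      unfolding reduce by (simp add: power_add mod_mult2_eq mult.commute [of "2 ^ l"])
    then have "\<phi> ((A + 1) \<rhd> i) =
        (x + 1) \<rhd> (((U + 1) \<rhd> i) div 2 ^ n mod 2 ^ l) + 2 ^ (m * n) * (((U + 1) \<rhd> i) mod 2 ^ n)"
      by (simp add: \<phi>_def)
    then show ?thesis using row laver_mod_period [OF pl] by simp
  qed
  have hom: "\<phi> (u \<rhd> v) = \<phi> u \<rhd> \<phi> v" if uv: "u \<in> laver_gen A" "v \<in> laver_gen A" for u v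
  proof -
    obtain i where "u = (A + 1) \<rhd> i" using uv(1) unfolding laver_gen_eq by (rule rangeE)
    moreover obtain j where "v = (A + 1) \<rhd> j" using uv(2) unfolding laver_gen_eq by (rule rangeE)
    ultimately show ?thesis by (simp only: laver_distrib [symmetric] \<phi>_row)
  qed
  \<comment> \<open>Modulo \<open>2 ^ d\<close> only the offset survives, since the row of
    \<open>x + 1\<close> consists of multiples of \<open>2 ^ d\<close>. The block indices lie below
    the period \<open>2 ^ l\<close>, where that row is injective.\<close>
  have inj: "inj_on \<phi> (laver_gen A)"
  proof (rule inj_onI)
    fix u v assume uv: "u \<in> laver_gen A" "v \<in> laver_gen A" "\<phi> u = \<phi> v"
    have bound: "v div 2 ^ n < 2 ^ l" if v: "v \<in> laver_gen A" for v
    proof -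
      obtain i where "v = (A + 1) \<rhd> i" using v unfolding laver_gen_eq by (rule rangeE)
      then have "v < 2 ^ l * 2 ^ n" using laver_less [of "A + 1" i] Ale by (simp add: power_add)
      then show ?thesis by (rule less_mult_imp_div_less)
    qed
    have \<phi>_mod: "\<phi> v mod 2 ^ d = 2 ^ (m * n) * (v mod 2 ^ n)" for v
    proof -
      obtain q where "x = 2 ^ d * q" using dx ..
      then have "(x + 1) mod 2 ^ d = 1 mod 2 ^ d" by (simp only: mod_mult_self4)
      moreover have "(1::nat) < 2 ^ d" using d(2) by (intro one_less_power) simp_all
      ultimately have "(x + 1) mod 2 ^ d = 1" by (simp only: mod_less)
      then have "((x + 1) \<rhd> i) mod 2 ^ d = 0" for i
        using laver_mod [of "x + 1" i d] laver_less [of 1] by simp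
      then have "2 ^ d dvd (x + 1) \<rhd> (v div 2 ^ n)" by (simp add: dvd_eq_mod_eq_0)
      then obtain c where "(x + 1) \<rhd> (v div 2 ^ n) = 2 ^ d * c" ..
      moreover have "2 ^ (m * n) * (v mod 2 ^ n) < 2 ^ d" by (simp add: d(1) power_add)
      ultimately show ?thesis unfolding \<phi>_def by (simp only: mod_mult_self4 mod_less)
    qed
    have "2 ^ (m * n) * (u mod 2 ^ n) = 2 ^ (m * n) * (v mod 2 ^ n)" using \<phi>_mod uv(3) by metis
    then have m: "u mod 2 ^ n = v mod 2 ^ n" by simp
    then have "(x + 1) \<rhd> (u div 2 ^ n) = (x + 1) \<rhd> (v div 2 ^ n)"
      using uv(3) by (simp add: \<phi>_def)
    then have "u div 2 ^ n = v div 2 ^ n"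
      using inj_onD [OF laver_inj_on_period [of "x + 1"]] bound uv(1,2) assms(5) by simp
    then show "u = v" using m by (metis mult_div_mod_eq)
  qed
  have "\<phi> ` laver_gen A = laver_gen a"
    using \<phi>_row by (auto simp: laver_gen_eq image_image)
  then have iso: "laver_iso \<phi> (laver_gen A) (laver_gen a)"
    using inj hom by (simp add: laver_iso_def bij_betw_def)
  have "\<phi> ((A + 1) \<rhd> i) = (a + 1) \<rhd> i \<and> (a + 1) \<rhd> i = (x + 1) \<rhd> w + 2 ^ (m * n) * y'"
    if "y' < 2 ^ n" "(A + 1) \<rhd> i = 2 ^ n * w + y'" for i w y'
    using \<phi>_row [of i] that by (simp add: \<phi>_def)
  then show ?thesis using iso unfolding A_def by blast
qed

end
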